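(* Let $\Omega\subset\mathbb{C}^n$ be a bounded convex domain with $\mathcal{C}^1$-smooth boundary. Suppose that there exist a constant $r>0$, a function $\omega:[0,2r)\to[0,\infty)$ satisfying a Dini condition, and a defining function $\rho$ for $\Omega$ such that for each $\xi\in\partial\Omega$ the directional derivative $D_{i\eta^{\xi}}\rho$ has modulus of continuity $\omega$ on the ball $B^{(n)}(\xi,r)$. Then there exist $K\ge 1$ and $\epsilon>0$ such that for every $\xi\in\partial\Omega$ the formula $$\sigma_\xi(t)=\xi+\epsilon e^{-2t}\eta^\xi,\quad t\in[0,\infty),$$ defines a map $\sigma_\xi:[0,\infty)\to\Omega$ that is a $K$-almost-geodesic in $\Omega$.
   Context: Notation: $\mathbb{C}^n$ is identified with $\mathbb{R}^{2n}$ in the usual way; $B^{(n)}(a,r)$ is the open Euclidean ball in $\mathbb{C}^n$ with centre $a$ and radius $r$; $\mathsf{k}_\Omega$ is the Kobayashi distance on $\Omega$, normalized so that on the unit disk $\mathsf{k}_{\mathbb{D}}(0,\zeta)=\frac12\log\frac{1+|\zeta|}{1-|\zeta|}$. $K$-almost-geodesic: for a bounded domain $\Omega$ and $K\ge1$, a $K$-almost-geodesic in $\Omega$ (with respect to the Kobayashi distance) is a map $\sigma:I\to\Omega$, $I\subset\mathbb{R}$ an interval, such that for all $s,t\in I$: (1) $|s-t|-\log K\le\mathsf{k}_\Omega(\sigma(s),\sigma(t))\le|s-t|+\log K$, and (2) $\mathsf{k}_\Omega(\sigma(s),\sigma(t))\le K|s-t|$. Boundary data: a defining function for a bounded domain $\Omega$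 with $\mathcal{C}^1$ boundary is a real-valued $\mathcal{C}^1$ function $\rho$ on a neighbourhood $U$ of $\partial\Omega$ with $\Omega\cap U=\{\rho<0\}$, $\partial\Omega=\{\rho=0\}$, and $D\rho\neq 0$ on $\partial\Omega$; $U$ is understood to contain the balls $B^{(n)}(\xi,r)$, $\xi\in\partial\Omega$, occurring in the statement. For $\xi\in\partial\Omega$, $\eta^\xi$ is the unit inward-pointing normal to $\partial\Omega$ at $\xi$, regarded as a vector in $\mathbb{C}^n$, and $i\eta^\xi$ is its product with $i$. For a unit vector $v$, $D_v\rho$ is the real directional derivative of $\rho$ in the direction $v$. Modulus of continuity: a function $f$ on a ball $B^{(n)}(\xi,r)$ has modulus of continuity $\omega:[0,2r)\to[0,\infty)$ if $\omega$ is non-decreasing, $\omega(0)=0$, $\omega$ is continuous at $0$, and $|f(x)-f(y)|\le\omega(\|x-y\|)$ for all $x,y$ in the ball. Dini condition: a Lebesgue-measurable $g:[0,\epsilon_0)\to[0,\infty)$, $\epsilon_0>0$, satisfies a Dini condition if $\int_0^{\epsilon_0}\frac{g(t)}{t}\,dt<\infty$. *)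

theory Defs
  imports "HOL-Complex_Analysis.Complex_Analysis"
begin

text \<open>
  The space C^n is the type \<^typ>\<open>complex ^ 'n\<close>. Its norm is the Euclidean one and its
  \<^emph>\<open>real\<close> inner product \<^const>\<open>inner\<close> is that of R^(2n) (the real part of the Hermitian
  product).
\<close>

section \<open>The Kobayashi distance\<close>

definition poincare_dist :: "complex \<Rightarrow> complex \<Rightarrow> real" where
  "poincare_dist a b =
     (let m = cmod ((a - b) / (1 - cnj b * a)) in 1 / 2 * ln ((1 + m) / (1 - m)))"

lemma poincare_dist_0:
  "poincare_dist 0 \<zeta> = 1 / 2 * ln ((1 + cmod \<zeta>) / (1 - cmod \<zeta>))"
  by (simp add: poincare_dist_def Let_def)

definition holomorphic_disc :: "(complex ^ 'n) set \<Rightarrow> (complex \<Rightarrow> complex ^ 'n) \<Rightarrow> bool" where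
  "holomorphic_disc \<Omega> f \<longleftrightarrow>
     (\<forall>i. (\<lambda>z. f z $ i) holomorphic_on ball 0 1) \<and> f ` ball 0 1 \<subseteq> \<Omega>"

definition kobayashi_chain ::
  "(complex ^ 'n) set \<Rightarrow> complex ^ 'n \<Rightarrow> complex ^ 'n \<Rightarrow> nat \<Rightarrow>
   (nat \<Rightarrow> complex \<Rightarrow> complex ^ 'n) \<Rightarrow> (nat \<Rightarrow> complex) \<Rightarrow> (nat \<Rightarrow> complex) \<Rightarrow> bool" where
  "kobayashi_chain \<Omega> z w m f a b \<longleftrightarrow>
     (\<exists>p. p 0 = z \<and> p m = w \<and>
       (\<forall>k<m. holomorphic_disc \<Omega> (f k) \<and> a k \<in> ball 0 1 \<and> b k \<in> ball 0 1 \<and>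
              f k (a k) = p k \<and> f k (b k) = p (Suc k)))"

text \<open>
  The infimum is over a set that is bounded below by 0; it is nonempty whenever
  \<open>\<Omega>\<close> is open and connected and \<open>z, w \<in> \<Omega>\<close>.
\<close>

definition kobayashi_dist :: "(complex ^ 'n) set \<Rightarrow> complex ^ 'n \<Rightarrow> complex ^ 'n \<Rightarrow> real" where
  "kobayashi_dist \<Omega> z w =
     Inf {\<Sum>k<m. poincare_dist (a k) (b k) | m f a b. kobayashi_chain \<Omega> z w m f a b}"

definition almost_geodesic ::
  "(complex ^ 'n) set \<Rightarrow> real \<Rightarrow> real set \<Rightarrow> (real \<Rightarrow> complex ^ 'n) \<Rightarrow> bool" where
  "almost_geodesic \<Omega> K I \<sigma> \<longleftrightarrow>
     1 \<le> K \<and> is_interval I \<and> \<sigma> ` I \<subseteq> \<Omega> \<and>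
     (\<forall>s\<in>I. \<forall>t\<in>I.
        \<bar>s - t\<bar> - ln K \<le> kobayashi_dist \<Omega> (\<sigma> s) (\<sigma> t) \<and>
        kobayashi_dist \<Omega> (\<sigma> s) (\<sigma> t) \<le> \<bar>s - t\<bar> + ln K \<and>
        kobayashi_dist \<Omega> (\<sigma> s) (\<sigma> t) \<le> K * \<bar>s - t\<bar>)"

section \<open>Boundary data\<close>

definition C1_on :: "'a::real_normed_vector set \<Rightarrow> ('a \<Rightarrow> real) \<Rightarrow> bool" where
  "C1_on U \<rho> \<longleftrightarrow>
     (\<exists>\<rho>' :: 'a \<Rightarrow> 'a \<Rightarrow>\<^sub>L real.
        (\<forall>x\<in>U. (\<rho> has_derivative blinfun_apply (\<rho>' x)) (at x)) \<and> continuous_on U \<rho>')"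

text \<open>
  Only the part of the frontier inside \<open>U\<close> is described here, so that the same predicate
  serves for local and for global defining functions.
\<close>

definition defining_function_on ::
  "'a::real_normed_vector set \<Rightarrow> 'a set \<Rightarrow> ('a \<Rightarrow> real) \<Rightarrow> bool" where
  "defining_function_on \<Omega> U \<rho> \<longleftrightarrow>
     open U \<and> C1_on U \<rho> \<and>
     \<Omega> \<inter> U = {x \<in> U. \<rho> x < 0} \<and>
     frontier \<Omega> \<inter> U = {x \<in> U. \<rho> x = 0} \<and>
     (\<forall>x \<in> frontier \<Omega> \<inter> U. frechet_derivative \<rho> (at x) \<noteq> (\<lambda>v. 0))"

definition C1_boundary :: "'a::real_normed_vector set \<Rightarrow> bool" where
  "C1_boundary \<Omega> \<longleftrightarrow> (\<forall>\<xi> \<in> frontier \<Omega>. \<exists>V \<rho>. \<xi> \<in> V \<and> defining_function_on \<Omega> V \<rho>)"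

definition defining_function ::
  "'a::real_normed_vector set \<Rightarrow> 'a set \<Rightarrow> ('a \<Rightarrow> real) \<Rightarrow> bool" where
  "defining_function \<Omega> U \<rho> \<longleftrightarrow> frontier \<Omega> \<subseteq> U \<and> defining_function_on \<Omega> U \<rho>"

definition tangent_space :: "'a::real_normed_vector set \<Rightarrow> 'a \<Rightarrow> 'a set" where
  "tangent_space M \<xi> =
     {v. \<exists>\<gamma>. \<gamma> ` {-1<..<1} \<subseteq> M \<and> \<gamma> 0 = \<xi> \<and> (\<gamma> has_vector_derivative v) (at (0::real))}"

text \<open>If \<open>\<Omega>\<close> has C^1 boundary and \<open>\<xi>\<close> lies on it, there is exactly one such vector.\<close>

definition inward_normal :: "'a::real_inner set \<Rightarrow> 'a \<Rightarrow> 'a" where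
  "inward_normal \<Omega> \<xi> =
     (THE \<eta>. norm \<eta> = 1 \<and> (\<forall>v \<in> tangent_space (frontier \<Omega>) \<xi>. inner \<eta> v = 0) \<and>
            (\<exists>\<delta>>0. \<forall>t. 0 < t \<and> t < \<delta> \<longrightarrow> \<xi> + t *\<^sub>R \<eta> \<in> \<Omega>))"

definition dir_deriv :: "'a::real_normed_vector \<Rightarrow> ('a \<Rightarrow> real) \<Rightarrow> 'a \<Rightarrow> real" where
  "dir_deriv v \<rho> x = deriv (\<lambda>t::real. \<rho> (x + t *\<^sub>R v)) 0"

section \<open>Moduli of continuity and the Dini condition\<close>

definition modulus_of_continuity_on_ball ::
  "('a::real_normed_vector \<Rightarrow> real) \<Rightarrow> 'a \<Rightarrow> real \<Rightarrow> (real \<Rightarrow> real) \<Rightarrow> bool" where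
  "modulus_of_continuity_on_ball f \<xi> r \<omega> \<longleftrightarrow>
     (\<forall>t\<in>{0..<2 * r}. 0 \<le> \<omega> t) \<and> mono_on {0..<2 * r} \<omega> \<and> \<omega> 0 = 0 \<and>
     continuous (at 0 within {0..<2 * r}) \<omega> \<and>
     (\<forall>x \<in> ball \<xi> r. \<forall>y \<in> ball \<xi> r. \<bar>f x - f y\<bar> \<le> \<omega> (norm (x - y)))"

definition dini_condition :: "real \<Rightarrow> (real \<Rightarrow> real) \<Rightarrow> bool" where
  "dini_condition e g \<longleftrightarrow>
     0 < e \<and> (\<forall>t \<in> {0..<e}. 0 \<le> g t) \<and>
     g \<in> borel_measurable (lebesgue_on {0..<e}) \<and>
     (\<integral>\<^sup>+ t \<in> {0<..<e}. ennreal (g t / t) \<partial>lebesgue) < \<infinity>"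

end

theory Submission
  imports Defs
begin

text \<open>
  Lower bound: \<open>\<Omega>\<close> lies in the half space \<open>\<langle>x - \<xi>, \<eta>\<rangle> > 0\<close>, on which \<open>x \<mapsto> ln \<langle>x - \<xi>, \<eta>\<rangle> / 2\<close> is
  1-Lipschitz for the Kobayashi distance by Harnack's inequality.

  Upper bound: since \<open>D\<^sub>i\<^sub>\<eta> \<rho>\<close> vanishes at \<open>\<xi>\<close>, the complex normal slice of \<open>\<Omega>\<close> at \<open>\<xi>\<close> contains
  all \<open>\<zeta>\<close> near 0 with \<open>\<bar>\<zeta>\<bar> \<omega>(\<bar>\<zeta>\<bar>) < C Re \<zeta>\<close>. Instead of the boundary regularity of a Riemann map,
  an explicit map of the half plane into this set is used, namely
  \<open>F(z) = z + \<Sum>\<^sub>k c\<^sub>k a\<^sub>k z / (z + a\<^sub>k)\<close> with \<open>a\<^sub>k = R / 2\<^sup>k\<close> and \<open>c\<^sub>k\<close> a multiple of \<open>\<omega>(2 a\<^sub>k)\<close>: each summand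
  has nonnegative real part, comparable to \<open>c\<^sub>k \<bar>z\<bar>\<close> when \<open>\<bar>z\<bar>\<close> is about \<open>a\<^sub>k\<close>, and the Dini condition makes
  \<open>\<Sum>\<^sub>k c\<^sub>k\<close> converge. On the positive axis \<open>x \<le> F(x) \<le> 2x\<close>, so \<open>F\<close> distorts the Poincare distance along
  the normal by a bounded amount.
\<close>

section \<open>Poincare and Kobayashi distances\<close>

lemma poincare_dist_Moebius:
  "poincare_dist a b = 1 / 2 * ln ((1 + cmod (Moebius_function 0 b a)) / (1 - cmod (Moebius_function 0 b a)))"
  by (simp add: poincare_dist_def Let_def Moebius_function_simple)

lemma Moebius_function_norm_commute: "cmod (Moebius_function 0 b a) = cmod (Moebius_function 0 a b)"
proof -
  have "cnj (1 - cnj b * a) = 1 - cnj a * b"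
    by simp
  then have "cmod (1 - cnj b * a) = cmod (1 - cnj a * b)"
    by (metis complex_mod_cnj)
  then show ?thesis
    by (simp add: Moebius_function_simple norm_divide norm_minus_commute)
qed

lemma poincare_dist_commute: "poincare_dist a b = poincare_dist b a"
  by (simp add: poincare_dist_Moebius Moebius_function_norm_commute)

lemma poincare_dist_nonneg:
  assumes "a \<in> ball 0 1" "b \<in> ball 0 1"
  shows "0 \<le> poincare_dist a b"
proof -
  have "cmod (Moebius_function 0 b a) < 1"
    using assms by (intro Moebius_function_norm_lt_1) auto
  then show ?thesis
    by (simp add: poincare_dist_Moebius field_simps)
qed

section \<open>Schwarz-Pick and Harnack inequalities for the right half plane\<close>

text \<open>The imaginary parts add the same \<open>?d\<close> to both squared moduli, and
  \<open>m\<^sup>2 * ?d\<close> is at most \<open>?d\<close>, so the hypothesis descends to the real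
  parts alone.\<close>

lemma Re_le_of_pseudohyperbolic_le:
  assumes m: "0 \<le> m" "m < 1" and "0 < Re p" "0 < Re w"
    and le: "cmod (w - p) \<le> m * cmod (w + cnj p)"
  shows "Re w * (1 - m) \<le> Re p * (1 + m)"
proof -
  let ?d = "(Im w - Im p)\<^sup>2"
  have "(cmod (w - p))\<^sup>2 \<le> (m * cmod (w + cnj p))\<^sup>2"
    using le by (intro power_mono) auto
  then have "(Re w - Re p)\<^sup>2 + ?d \<le> m\<^sup>2 * ((Re w + Re p)\<^sup>2 + ?d)"
    by (simp add: cmod_power2 power_mult_distrib)
  moreover have "m\<^sup>2 * ?d \<le> ?d"
    using m by (intro mult_left_le_one_le) (auto simp: power_le_one)
  ultimately have "(Re w - Re p)\<^sup>2 \<le> m\<^sup>2 * (Re w + Re p)\<^sup>2"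
    unfolding distrib_left by linarith
  then have "(Re w - Re p)\<^sup>2 \<le> (m * (Re w + Re p))\<^sup>2"
    unfolding power_mult_distrib .
  then have "Re w - Re p \<le> m * (Re w + Re p)"
    using assms by (intro power2_le_imp_le[of "Re w - Re p"]) auto
  then show ?thesis
    by (simp add: algebra_simps)
qed

text \<open>The Cayley transform w -> (w - h b) / (w + cnj (h b)) sends the right half plane into
  the unit disc and \<open>h b\<close> to 0. Precomposing with the automorphism
  \<open>\<phi>\<close>, which takes 0 to \<open>b\<close>, gives a self-map of the disc fixing 0,
  to which the Schwarz lemma applies.\<close>

lemma Schwarz_Pick_right_half_plane:
  assumes h: "h holomorphic_on ball 0 1" and pos: "\<And>z. z \<in> ball 0 1 \<Longrightarrow> 0 < Re (h z)"
    and a: "a \<in> ball 0 1" and b: "b \<in> ball 0 1"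
  shows "cmod (h a - h b) \<le> cmod (Moebius_function 0 b a) * cmod (h a + cnj (h b))"
proof -
  define \<phi> where "\<phi> = Moebius_function 0 (-b)"
  define g where "g = (\<lambda>z. (h (\<phi> z) - h b) / (h (\<phi> z) + cnj (h b)))"
  have \<phi>: "\<phi> ` ball 0 1 \<subseteq> ball 0 1" "\<phi> holomorphic_on ball 0 1" "\<phi> 0 = b"
    using b by (auto simp: \<phi>_def Moebius_function_norm_lt_1 Moebius_function_of_zero intro: Moebius_function_holomorphic)
  have ne: "h z + cnj (h b) \<noteq> 0" if "z \<in> ball 0 1" for z
    using pos[OF that] pos[OF b] by (auto simp: complex_eq_iff)
  have "(h \<circ> \<phi>) holomorphic_on ball 0 1"
    using \<phi> h by (intro holomorphic_on_compose_gen) auto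
  then have hol: "g holomorphic_on ball 0 1"
    unfolding g_def o_def using ne \<phi> by (intro holomorphic_intros) blast+
  have lt: "cmod (g z) < 1" if "cmod z < 1" for z
  proof -
    have z: "\<phi> z \<in> ball 0 1" using \<phi>(1) that by (auto simp: image_subset_iff)
    let ?w = "h (\<phi> z)" and ?p = "h b"
    \<comment> \<open>The two squared moduli compared next differ by four times this
      product.\<close>
    have "0 < Re ?w * Re ?p"
      using pos[OF z] pos[OF b] by simp
    then have "(cmod (?w - ?p))\<^sup>2 < (cmod (?w + cnj ?p))\<^sup>2"
      unfolding cmod_power2 by (simp add: power2_eq_square algebra_simps)
    then have "cmod (?w - ?p) < cmod (?w + cnj ?p)"
      by (rule power2_less_imp_less) auto
    then show ?thesis
      using ne[OF z] by (simp add: g_def norm_divide)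
  qed
  define \<zeta> where "\<zeta> = Moebius_function 0 b a"
  have "cmod \<zeta> < 1" "\<phi> \<zeta> = a"
    using a b by (auto simp: \<zeta>_def \<phi>_def Moebius_function_norm_lt_1 Moebius_function_compose)
  moreover have "g 0 = 0"
    by (simp add: g_def \<phi>)
  ultimately have "cmod (g \<zeta>) \<le> cmod \<zeta>"
    using Schwarz_Lemma(1)[OF hol] lt by blast
  then show ?thesis
    using ne[OF a] \<open>\<phi> \<zeta> = a\<close>
    by (simp add: g_def norm_divide field_simps \<zeta>_def)
qed

text \<open>The extremal Harnack ratio (1 + m) / (1 - m) is the exponential of twice the Poincare
  distance. Exchanging \<open>a\<close> and \<open>b\<close> gives the opposite sign.\<close>

lemma Harnack_poincare_dist:
  assumes h: "h holomorphic_on ball 0 1" and pos: "\<And>z. z \<in> ball 0 1 \<Longrightarrow> 0 < Re (h z)"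
    and a: "a \<in> ball 0 1" and b: "b \<in> ball 0 1"
  shows "(ln (Re (h a)) - ln (Re (h b))) / 2 \<le> poincare_dist a b"
proof -
  define m where "m = cmod (Moebius_function 0 b a)"
  have m: "0 \<le> m" "m < 1"
    using a b by (auto simp: m_def Moebius_function_norm_lt_1)
  have "Re (h a) * (1 - m) \<le> Re (h b) * (1 + m)"
    using Schwarz_Pick_right_half_plane[OF h pos a b] m pos a b
    by (intro Re_le_of_pseudohyperbolic_le) (auto simp: m_def)
  then have "Re (h a) / Re (h b) \<le> (1 + m) / (1 - m)"
    using m pos[OF b] by (simp add: field_simps)
  then have "ln (Re (h a) / Re (h b)) \<le> ln ((1 + m) / (1 - m))"
    using m pos[OF a] pos[OF b] by (subst ln_le_cancel_iff) auto
  then show ?thesis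
    using pos[OF a] pos[OF b] by (simp add: poincare_dist_Moebius m_def ln_div)
qed

section \<open>Kobayashi distance: upper bounds from discs, lower bounds from half spaces\<close>

lemma kobayashi_chain_of_disc:
  assumes "holomorphic_disc \<Omega> f" "a \<in> ball 0 1" "b \<in> ball 0 1"
  shows "kobayashi_chain \<Omega> (f a) (f b) 1 (\<lambda>_. f) (\<lambda>_. a) (\<lambda>_. b)"
  unfolding kobayashi_chain_def using assms
  by (intro exI[of _ "\<lambda>k. if k = 0 then f a else f b"]) auto

lemma kobayashi_dist_le_poincare_dist:
  assumes "holomorphic_disc \<Omega> f" "a \<in> ball 0 1" "b \<in> ball 0 1"
  shows "kobayashi_dist \<Omega> (f a) (f b) \<le> poincare_dist a b"
  unfolding kobayashi_dist_def
proof (rule cInf_lower)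
  show "poincare_dist a b \<in> {\<Sum>k<m. poincare_dist (a' k) (b' k) |m f' a' b'. kobayashi_chain \<Omega> (f a) (f b) m f' a' b'}"
    using kobayashi_chain_of_disc[OF assms] by (intro CollectI exI[of _ "1::nat"] exI conjI) auto
  show "bdd_below {\<Sum>k<m. poincare_dist (a' k) (b' k) |m f' a' b'. kobayashi_chain \<Omega> (f a) (f b) m f' a' b'}"
    by (intro bdd_belowI[of _ 0]) (auto simp: kobayashi_chain_def intro!: sum_nonneg poincare_dist_nonneg)
qed

text \<open>Harnack's inequality bounds the change of the logarithm along each link of a chain, and
  these changes telescope. The chain in \<open>ne\<close> ensures that the infimum is not taken over
  the empty set.\<close>

lemma kobayashi_dist_ge_half_space:
  fixes \<Omega> :: "(complex ^ 'n) set"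
  assumes half: "\<And>x. x \<in> \<Omega> \<Longrightarrow> 0 < inner (x - \<xi>) \<eta>"
    and ne: "kobayashi_chain \<Omega> z w m\<^sub>0 f\<^sub>0 a\<^sub>0 b\<^sub>0"
  shows "\<bar>ln (inner (z - \<xi>) \<eta>) - ln (inner (w - \<xi>) \<eta>)\<bar> / 2 \<le> kobayashi_dist \<Omega> z w"
  unfolding kobayashi_dist_def
proof (rule cInf_greatest)
  show "{\<Sum>k<m. poincare_dist (a k) (b k) |m f a b. kobayashi_chain \<Omega> z w m f a b} \<noteq> {}"
    using ne by blast
  fix d assume "d \<in> {\<Sum>k<m. poincare_dist (a k) (b k) |m f a b. kobayashi_chain \<Omega> z w m f a b}"
  then obtain m f a b where d: "d = (\<Sum>k<m. poincare_dist (a k) (b k))"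
    and c: "kobayashi_chain \<Omega> z w m f a b"
    by blast
  then obtain p where p: "p 0 = z" "p m = w" and chain: "\<And>k. k < m \<Longrightarrow> holomorphic_disc \<Omega> (f k) \<and> a k \<in> ball 0 1 \<and>
       b k \<in> ball 0 1 \<and> f k (a k) = p k \<and> f k (b k) = p (Suc k)"
    unfolding kobayashi_chain_def by blast
  define L where "L x = ln (inner (x - \<xi>) \<eta>)" for x
  have step: "\<bar>L (p k) - L (p (Suc k))\<bar> / 2 \<le> poincare_dist (a k) (b k)" if "k < m" for k
  proof -
    \<comment> \<open>The Hermitian pairing with \<eta> is complex linear in its first argument, so
      \<open>h\<close> is holomorphic, and its real part is the real inner product.\<close>
    define h where "h = (\<lambda>z. \<Sum>i\<in>UNIV. (f k z - \<xi>) $ i * cnj (\<eta> $ i))"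
    have Re_h: "Re (h z) = inner (f k z - \<xi>) \<eta>" for z
      by (simp add: h_def inner_vec_def inner_complex_def)
    have hol: "h holomorphic_on ball 0 1"
      using chain[OF that] unfolding h_def holomorphic_disc_def
      by (auto intro!: holomorphic_intros)
    have pos: "0 < Re (h z)" if "z \<in> ball 0 1" for z
      using chain[OF \<open>k < m\<close>] half that unfolding Re_h holomorphic_disc_def by blast
    have "a k \<in> ball 0 1" "b k \<in> ball 0 1"
      using chain[OF that] by auto
    from Harnack_poincare_dist[OF hol pos this] Harnack_poincare_dist[OF hol pos this(2,1)]
    show ?thesis
      using chain[OF that] by (auto simp: L_def Re_h poincare_dist_commute abs_if)
  qed
  have "\<bar>L (p 0) - L (p m)\<bar> / 2 \<le> (\<Sum>k<m. \<bar>L (p k) - L (p (Suc k))\<bar> / 2)"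
    using sum_abs[of "\<lambda>k. L (p k) - L (p (Suc k))" "{..<m}"] sum_lessThan_telescope'[of "\<lambda>k. L (p k)" m]
    by (simp flip: sum_divide_distrib)
  also have "\<dots> \<le> d"
    unfolding d using step by (intro sum_mono) auto
  finally show "\<bar>ln (inner (z - \<xi>) \<eta>) - ln (inner (w - \<xi>) \<eta>)\<bar> / 2 \<le> d"
    by (simp add: p L_def)
qed

text \<open>The distance is exactly half the logarithm of (v/u) (2 - u)/(2 - v). Bounding the last
  factor by 2 gives an estimate with additive error; bounding it by v/u gives one that vanishes at u
  = v, as the Lipschitz condition requires.\<close>

lemma poincare_dist_real_le:
  fixes u v :: real
  assumes "0 < u" "u \<le> v" "v \<le> 1"
  shows "poincare_dist (of_real (1 - u)) (of_real (1 - v)) \<le> ln (2 * (v / u)) / 2"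
    and "poincare_dist (of_real (1 - u)) (of_real (1 - v)) \<le> ln (v / u)"
proof -
  define m where "m = (v - u) / (u + v - u * v)"
  have "u * v \<le> u"
    using assms by (simp add: mult_left_le)
  then have D: "0 < u + v - u * v" "0 < v * (2 - u)" "0 < u * (2 - v)" using assms by (smt (verit) mult_pos_pos)+
  have "(of_real (1 - u) - of_real (1 - v)) / (1 - cnj (of_real (1 - v)) * of_real (1 - u)) = (of_real m :: complex)"
    by (simp add: m_def algebra_simps)
  moreover have "0 \<le> m" using assms D by (simp add: m_def)
  ultimately have "poincare_dist (of_real (1 - u)) (of_real (1 - v)) = ln ((1 + m) / (1 - m)) / 2"
    by (simp add: poincare_dist_def Let_def)
  moreover have "1 + m = v * (2 - u) / (u + v - u * v)" "1 - m = u * (2 - v) / (u + v - u * v)"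
    using D by (auto simp: m_def field_simps)
  ultimately have eq: "poincare_dist (of_real (1 - u)) (of_real (1 - v)) = ln (v / u * ((2 - u) / (2 - v))) / 2"
    using D by simp
  have q: "0 < v / u" "0 < (2 - u) / (2 - v)" using assms by auto
  have "(2 - u) / (2 - v) \<le> 2"
    using assms by (simp add: field_simps)
  then have "ln (v / u * ((2 - u) / (2 - v))) \<le> ln (v / u * 2)"
    using q by (intro ln_mono mult_left_mono mult_pos_pos) auto
  then show "poincare_dist (of_real (1 - u)) (of_real (1 - v)) \<le> ln (2 * (v / u)) / 2"
    unfolding eq by (simp add: mult.commute)
  have "0 \<le> (v - u) * (2 - u - v)" using assms by auto
  then have "(2 - u) / (2 - v) \<le> v / u"
    using assms by (simp add: field_simps)
  then have "ln (v / u * ((2 - u) / (2 - v))) \<le> ln (v / u * (v / u))"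
    using q by (intro ln_mono mult_left_mono mult_pos_pos) auto
  also have "\<dots> = 2 * ln (v / u)"
    using q(1) ln_mult_pos[OF q(1) q(1)] by simp
  finally show "poincare_dist (of_real (1 - u)) (of_real (1 - v)) \<le> ln (v / u)"
    unfolding eq by simp
qed

section \<open>Dyadic form of the Dini condition\<close>

text \<open>By monotonicity g(s)/s is at least g(t)/(2t) on [t, 2t), so this interval contributes at
  least g(t)/2 to the Dini integral.\<close>

lemma monotone_interval_le_Dini_integral:
  assumes dini: "dini_condition e g" and mono: "mono_on {0..<e} g"
    and t: "0 < t" "2 * t \<le> e"
  shows "(\<integral>\<^sup>+ s \<in> {t..<2 * t}. ennreal (g t / (2 * t)) \<partial>lebesgue) = ennreal (g t / 2)"
    "\<And>s. s \<in> {t..<2 * t} \<Longrightarrow> ennreal (g t / (2 * t)) \<le> ennreal (g s / s)"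
proof -
  have g: "0 \<le> g t"
    using dini t by (auto simp: dini_condition_def)
  have "(\<integral>\<^sup>+ s \<in> {t..<2 * t}. ennreal (g t / (2 * t)) \<partial>lebesgue) = ennreal (g t / (2 * t)) * ennreal t"
    using t by (simp add: nn_integral_cmult_indicator)
  then show "(\<integral>\<^sup>+ s \<in> {t..<2 * t}. ennreal (g t / (2 * t)) \<partial>lebesgue) = ennreal (g t / 2)"
    using t g by (simp flip: ennreal_mult)
  fix s assume s: "s \<in> {t..<2 * t}"
  then have "g t \<le> g s"
    using t by (intro mono_onD[OF mono]) auto
  then show "ennreal (g t / (2 * t)) \<le> ennreal (g s / s)"
    using s t g by (intro ennreal_leI frac_le) auto
qed

text \<open>An integral test: the intervals [t_k, 2 t_k) with t_k = r/2^k are disjoint subsets of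
  (0, 2r), so the partial sums of g(t_k)/2 are bounded by the Dini integral.\<close>

lemma Dini_summable_dyadic:
  assumes dini: "dini_condition (2 * r) g" and mono: "mono_on {0..<2 * r} g"
  shows "summable (\<lambda>k. g (r / 2 ^ k))"
proof -
  have r: "0 < r" using dini by (simp add: dini_condition_def)
  define t where "t k = r / 2 ^ k" for k :: nat
  have t: "0 < t k" "2 * t k \<le> 2 * r" "2 * t (Suc k) = t k" for k
    using r by (auto simp: t_def divide_simps)
  have t_less: "2 * t j \<le> t k" if "k < j" for k j
  proof -
    have "2 * t j \<le> 2 * t (Suc k)"
      using that r unfolding t_def by (intro mult_left_mono divide_left_mono power_increasing) auto
    then show ?thesis by (simp add: t)
  qed
  have g: "0 \<le> g (t k)" for k
    using dini t[of k] by (auto simp: dini_condition_def)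
  define J where "J = (\<integral>\<^sup>+ s \<in> {0<..<2 * r}. ennreal (g s / s) \<partial>lebesgue)"
  define \<phi> where "\<phi> k s = ennreal (g (t k) / (2 * t k)) * indicator {t k..<2 * t k} s" for k s
  have \<phi>_le: "\<phi> k s \<le> ennreal (g s / s) * indicator {0<..<2 * r} s" for k s
    using monotone_interval_le_Dini_integral(2)[OF dini mono t(1,2), of s k] t[of k]
    by (auto simp: \<phi>_def indicator_def)
  \<comment> \<open>By disjointness at most one summand is nonzero at any given
    \<open>s\<close>.\<close>
  have sum_le: "(\<Sum>k<n. \<phi> k s) \<le> ennreal (g s / s) * indicator {0<..<2 * r} s" for n s
  proof (cases "\<exists>k<n. s \<in> {t k..<2 * t k}")
    case True
    then obtain k where k: "k < n" "s \<in> {t k..<2 * t k}" by blast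
    have "\<phi> j s = 0" if "j \<noteq> k" for j
      using k t_less[of j k] t_less[of k j] that by (fastforce simp: \<phi>_def indicator_def neq_iff)
    then have "(\<Sum>k<n. \<phi> k s) = (\<Sum>k\<in>{k}. \<phi> k s)"
      using k by (intro sum.mono_neutral_right) auto
    then show ?thesis using \<phi>_le by simp
  next
    case False
    then have "(\<Sum>k<n. \<phi> k s) = 0"
      by (intro sum.neutral) (auto simp: \<phi>_def)
    then show ?thesis by simp
  qed
  have "ennreal (\<Sum>k<n. g (t k) / 2) \<le> J" for n
  proof -
    have "ennreal (\<Sum>k<n. g (t k) / 2) = (\<Sum>k<n. \<integral>\<^sup>+ s. \<phi> k s \<partial>lebesgue)"
      using g monotone_interval_le_Dini_integral(1)[OF dini mono t(1,2)]
      by (simp add: \<phi>_def flip: sum_ennreal)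
    also have "\<dots> = (\<integral>\<^sup>+ s. (\<Sum>k<n. \<phi> k s) \<partial>lebesgue)"
      by (intro nn_integral_sum[symmetric] measurable_completion) (simp add: \<phi>_def[abs_def])
    also have "\<dots> \<le> J"
      unfolding J_def by (intro nn_integral_mono sum_le)
    finally show ?thesis .
  qed
  moreover have "J < \<infinity>"
    using dini by (simp add: dini_condition_def J_def)
  ultimately have "(\<Sum>k<n. g (t k) / 2) \<le> enn2real J" for n
    using g by (metis ennreal_le_iff enn2real_nonneg ennreal_enn2real infinity_ennreal_def)
  then have "summable (\<lambda>k. g (t k) / 2)"
    using g by (intro summableI_nonneg_bounded) auto
  then have "summable (\<lambda>k. 2 * (g (t k) / 2))"
    by (rule summable_mult)
  then show ?thesis by (simp add: t_def)
qed

text \<open>The last dyadic scale above \<open>x\<close> works: if \<open>k\<close> is the first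
  index with R/2^k at most \<open>x\<close>, its predecessor gives a scale above \<open>x\<close>
  but at most twice \<open>x\<close>. The predecessor exists because x < R.\<close>

lemma dyadic_scale_exists:
  fixes x R :: real
  assumes "0 < x" "x < R"
  obtains k where "x \<le> R / 2 ^ k" "R / 2 ^ k \<le> 2 * x"
proof -
  obtain n where n: "R / x < 2 ^ n"
    using real_arch_pow[of 2 "R / x"] by auto
  then have "R / 2 ^ n \<le> x"
    using assms by (simp add: field_simps)
  define k where "k = (LEAST k. R / 2 ^ k \<le> x)"
  have k: "R / 2 ^ k \<le> x"
    unfolding k_def using \<open>R / 2 ^ n \<le> x\<close> by (rule LeastI)
  moreover have "k \<noteq> 0"
    using k assms by (cases k) auto
  then obtain j where j: "k = Suc j" by (cases k) auto
  have "\<not> R / 2 ^ j \<le> x"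
    using not_less_Least[of j "\<lambda>k. R / 2 ^ k \<le> x"] j by (simp add: k_def)
  then show ?thesis
    using that[of j] k j by simp
qed

section \<open>Complex scalar multiples of vectors\<close>

lemma norm_vector_scalar_mult_complex: "norm (\<zeta> *s v) = cmod \<zeta> * norm v" for v :: "complex ^ 'n"
  by (simp add: norm_vec_def norm_mult L2_set_right_distrib)

lemma vector_scalar_mult_complex_split:
  "\<zeta> *s v = Re \<zeta> *\<^sub>R v + Im \<zeta> *\<^sub>R (\<i> *s v)" for v :: "complex ^ 'n"
  by (simp add: vec_eq_iff complex_eq_iff)

text \<open>The Hermitian product of v and iv is purely imaginary. Hence i\<eta> is a real tangent
  direction, and the derivative of \<rho> along it vanishes at the boundary point.\<close>

lemma inner_i_times_self: "v \<bullet> (\<i> *s v) = 0" for v :: "complex ^ 'n"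
  by (simp add: inner_vec_def inner_complex_def)

section \<open>A holomorphic map of the half plane into a pinched subdomain\<close>

text \<open>For nonzero z this is 1 / (1/z + 1/s), which explains why it preserves the right half
  plane; it looks like z for small z and like the constant s for large z.\<close>

definition bump :: "real \<Rightarrow> complex \<Rightarrow> complex" where
  "bump s z = of_real s * z / (z + of_real s)"

definition bump_map :: "(nat \<Rightarrow> real) \<Rightarrow> (nat \<Rightarrow> real) \<Rightarrow> complex \<Rightarrow> complex" where
  "bump_map c a z = z + (\<Sum>k. of_real (c k) * bump (a k) z)"

text \<open>The bound on the total weight makes the perturbation of the identity at most
  \<open>cmod z\<close> in modulus, so F at most doubles moduli. The scales become dyadic only in
  \<open>bump_map_pinched\<close>.\<close>

locale bumps =
  fixes c a :: "nat \<Rightarrow> real"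
  assumes c_nonneg: "0 \<le> c k" and a_pos: "0 < a k"
    and c_summable: "summable c" and c_le_1: "suminf c \<le> 1"
begin

lemma add_a_nonzero: "0 \<le> Re z \<Longrightarrow> z + of_real (a k) \<noteq> 0"
  using a_pos[of k] by (auto simp: complex_eq_iff)

lemma norm_bump_le:
  assumes "0 \<le> Re z"
  shows "cmod (of_real (c k) * bump (a k) z) \<le> c k * cmod z"
proof -
  have "a k \<le> Re (z + of_real (a k))" using assms by simp
  also have "\<dots> \<le> cmod (z + of_real (a k))" by (rule complex_Re_le_cmod)
  finally have "a k * cmod z / cmod (z + of_real (a k)) \<le> cmod z"
    using add_a_nonzero[OF assms, of k]
    by (simp add: field_simps mult_left_mono)
  then have "cmod (bump (a k) z) \<le> cmod z"
    using a_pos[of k] by (simp add: bump_def norm_mult norm_divide)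
  then show ?thesis
    using c_nonneg[of k] by (simp add: norm_mult mult_left_mono)
qed

lemma summable_bump:
  assumes "0 \<le> Re z"
  shows "summable (\<lambda>k. of_real (c k) * bump (a k) z)"
  using summable_mult2[OF c_summable] norm_bump_le[OF assms] by (rule summable_comparison_test')

lemma norm_bump_map_le:
  assumes "0 \<le> Re z"
  shows "cmod (bump_map c a z) \<le> 2 * cmod z"
proof -
  have "cmod (\<Sum>k. of_real (c k) * bump (a k) z) \<le> (\<Sum>k. c k * cmod z)"
    using summable_mult2[OF c_summable] norm_bump_le[OF assms] by (intro norm_suminf_le)
  also have "\<dots> = suminf c * cmod z"
    using c_summable by (rule suminf_mult2[symmetric])
  also have "\<dots> \<le> cmod z"
    using c_le_1 by (simp add: mult_left_le_one_le suminf_nonneg c_summable c_nonneg)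
  finally show ?thesis
    unfolding bump_map_def by norm
qed

text \<open>For s > 0 the numerator is a sum of nonnegative terms on the closed right half plane,
  and the term with \<open>(cmod z)\<^sup>2\<close> survives near the imaginary axis, where
  \<open>Re z\<close> gives nothing.\<close>

lemma Re_bump:
  "Re (bump s z) = s * ((cmod z)\<^sup>2 + s * Re z) / (cmod (z + of_real s))\<^sup>2"
proof -
  have "Re (bump s z) = Re (of_real s * z * cnj (z + of_real s)) / (cmod (z + of_real s))\<^sup>2"
    unfolding bump_def by (subst complex_div_cnj) (simp flip: of_real_power)
  also have "Re (of_real s * z * cnj (z + of_real s)) = s * ((cmod z)\<^sup>2 + s * Re z)"
    unfolding cmod_power2 by (simp add: power2_eq_square algebra_simps)
  finally show ?thesis .
qed

lemma Re_bump_nonneg: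
  assumes "0 \<le> Re z"
  shows "0 \<le> Re (of_real (c k) * bump (a k) z)"
  using assms c_nonneg[of k] a_pos[of k] by (simp add: Re_bump del: times_divide_eq_right)

text \<open>One bump at a scale comparable to \<open>cmod z\<close> suffices, since the others have
  nonnegative real part. There the denominator is at most 4 a^2 and the numerator at least a^2 |z| /
  2, whence the factor 1/8.\<close>

lemma Re_bump_map_ge:
  assumes "0 \<le> Re z" "a k \<le> 2 * cmod z" "cmod z \<le> a k"
  shows "Re z + c k * cmod z / 8 \<le> Re (bump_map c a z)"
proof -
  have "0 < cmod (z + of_real (a k))"
    using add_a_nonzero[OF assms(1)] by simp
  moreover have "cmod (z + of_real (a k)) \<le> 2 * a k"
    using norm_triangle_ineq[of z "of_real (a k)"] assms a_pos[of k] by simp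
  then have "(cmod (z + of_real (a k)))\<^sup>2 \<le> (2 * a k)\<^sup>2"
    by (intro power_mono) auto
  moreover have "cmod z * (a k)\<^sup>2 / 2 \<le> a k * (cmod z)\<^sup>2"
    using mult_right_mono[OF assms(2), of "a k * cmod z"] a_pos[of k] by (simp add: power2_eq_square mult_ac)
  moreover have "0 \<le> a k * (a k * Re z)"
    using assms a_pos[of k] by simp
  ultimately have "cmod z / 8 \<le> Re (bump (a k) z)"
  proof -
    have "cmod z / 8 * (cmod (z + of_real (a k)))\<^sup>2 \<le> cmod z / 8 * (2 * a k)\<^sup>2"
      using \<open>(cmod (z + of_real (a k)))\<^sup>2 \<le> (2 * a k)\<^sup>2\<close> by (intro mult_left_mono) auto
    also have "\<dots> = cmod z * (a k)\<^sup>2 / 2" by (simp add: power2_eq_square)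
    also have "\<dots> \<le> a k * ((cmod z)\<^sup>2 + a k * Re z)"
      using \<open>cmod z * (a k)\<^sup>2 / 2 \<le> a k * (cmod z)\<^sup>2\<close> \<open>0 \<le> a k * (a k * Re z)\<close>
      by (simp add: distrib_left)
    finally show ?thesis
      unfolding Re_bump using \<open>0 < cmod (z + of_real (a k))\<close> by (simp add: pos_le_divide_eq)
  qed
  from mult_left_mono[OF this c_nonneg[of k]]
  have "c k * cmod z / 8 \<le> (\<Sum>j\<in>{k}. Re (of_real (c j) * bump (a j) z))"
    by simp
  also have "\<dots> \<le> (\<Sum>j. Re (of_real (c j) * bump (a j) z))"
    using Re_bump_nonneg[OF assms(1)] summable_Re[OF summable_bump[OF assms(1)]]
    by (intro sum_le_suminf) auto
  also have "\<dots> = Re (\<Sum>j. of_real (c j) * bump (a j) z)"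
    by (rule Re_suminf[OF summable_bump[OF assms(1)], symmetric])
  finally show ?thesis by (simp add: bump_map_def)
qed

text \<open>Each summand is at most \<open>c k * cmod z\<close>, so the Weierstrass M-test gives
  uniform convergence on closed discs inside the half plane.\<close>

lemma bump_map_holomorphic: "bump_map c a holomorphic_on {z. 0 < Re z}"
proof (rule holomorphic_uniform_sequence)
  let ?b = "\<lambda>k z. of_real (c k) * bump (a k) z"
  show op: "open {z. 0 < Re z}" by (rule open_halfspace_Re_gt)
  show "(\<lambda>z. z + (\<Sum>k<n. ?b k z)) holomorphic_on {z. 0 < Re z}" for n
    unfolding bump_def by (intro holomorphic_intros) (auto dest!: less_imp_le simp: add_a_nonzero)
  fix x :: complex assume "x \<in> {z. 0 < Re z}"
  then obtain d where d: "0 < d" "cball x d \<subseteq> {z. 0 < Re z}"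
    using op open_contains_cball by blast
  have "uniform_limit (cball x d) (\<lambda>n z. \<Sum>k<n. ?b k z) (\<lambda>z. \<Sum>k. ?b k z) sequentially"
  proof (rule Weierstrass_m_test)
    fix k z assume z: "z \<in> cball x d"
    then have "cmod (?b k z) \<le> c k * cmod z"
      using d by (intro norm_bump_le) (auto simp: subset_iff less_imp_le)
    also have "cmod z \<le> cmod x + d"
      using z norm_triangle_ineq2[of z x] by (auto simp: dist_norm norm_minus_commute)
    finally show "cmod (?b k z) \<le> c k * (cmod x + d)"
      using c_nonneg by (simp add: mult_left_mono)
  qed (intro summable_mult2 c_summable)
  then have "uniform_limit (cball x d) (\<lambda>n z. z + (\<Sum>k<n. ?b k z)) (bump_map c a) sequentially"
    unfolding bump_map_def[abs_def] by (intro uniform_limit_intros)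
  then show "\<exists>d>0. cball x d \<subseteq> {z. 0 < Re z} \<and>
      uniform_limit (cball x d) (\<lambda>n z. z + (\<Sum>k<n. ?b k z)) (bump_map c a) sequentially"
    using d by blast
qed

section \<open>The map on the positive real axis\<close>

definition real_bump_map :: "real \<Rightarrow> real" where
  "real_bump_map x = x + (\<Sum>k. c k * (a k * x / (x + a k)))"

lemma bump_of_real: "of_real (c k) * bump (a k) (of_real x) = of_real (c k * (a k * x / (x + a k)))"
  by (simp add: bump_def)

lemma summable_real_bump: "0 \<le> x \<Longrightarrow> summable (\<lambda>k. c k * (a k * x / (x + a k)))"
  using summable_bump[of "of_real x"] unfolding bump_of_real summable_complex_of_real by simp

lemma bump_map_of_real:
  assumes "0 \<le> x"
  shows "bump_map c a (of_real x) = of_real (real_bump_map x)"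
  unfolding bump_map_def real_bump_map_def bump_of_real
  by (simp only: suminf_of_real[OF summable_real_bump[OF assms]] of_real_add)

text \<open>Every summand is nondecreasing in \<open>x\<close>, hence so is F minus the
  identity.\<close>

lemma real_bump_map_diff_ge:
  assumes "0 \<le> x" "x \<le> y"
  shows "y - x \<le> real_bump_map y - real_bump_map x"
proof -
  have "c k * (a k * x / (x + a k)) \<le> c k * (a k * y / (y + a k))" for k
  proof -
    have "x * (y + a k) \<le> y * (x + a k)"
      using assms a_pos[of k] by (simp add: algebra_simps)
    then have "x / (x + a k) \<le> y / (y + a k)"
      using assms a_pos[of k] by (simp add: divide_simps add_nonneg_pos)
    then show ?thesis
      using c_nonneg[of k] a_pos[of k] by (simp add: mult_left_mono flip: times_divide_eq_right)
  qed
  then show ?thesis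
    using assms summable_real_bump by (simp add: real_bump_map_def suminf_le)
qed

lemma real_bump_map_0: "real_bump_map 0 = 0"
  by (simp add: real_bump_map_def)

lemma real_bump_map_le:
  assumes "0 \<le> x"
  shows "real_bump_map x \<le> 2 * x"
  using norm_bump_map_le[of "of_real x"] assms by (simp add: bump_map_of_real)

lemma real_bump_map_surj:
  assumes "0 < y" "y \<le> X"
  obtains x where "0 < x" "x \<le> X" "real_bump_map x = y"
proof -
  have "real_bump_map (y / 2) \<le> y"
    using real_bump_map_le[of "y / 2"] assms by simp
  moreover have "y \<le> real_bump_map X"
    using real_bump_map_diff_ge[of 0 X] real_bump_map_0 assms by simp
  \<comment> \<open>Starting at y/2 instead of 0 keeps the interval inside the open half plane,
    where continuity follows from holomorphy.\<close>
  moreover have "continuous_on {y / 2..X} real_bump_map"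
  proof -
    have "continuous_on {z. 0 < Re z} (bump_map c a)"
      using bump_map_holomorphic by (rule holomorphic_on_imp_continuous_on)
    then have "continuous_on {y / 2..X} (\<lambda>x. bump_map c a (of_real x))"
      using assms by (elim continuous_on_compose2[OF _ continuous_on_of_real_id]) auto
    then have "continuous_on {y / 2..X} (\<lambda>x. Re (bump_map c a (of_real x)))"
      by (rule continuous_on_Re)
    then show ?thesis
      by (rule continuous_on_eq) (use assms in \<open>simp add: bump_map_of_real\<close>)
  qed
  ultimately obtain x where "y / 2 \<le> x" "x \<le> X" "real_bump_map x = y"
    using IVT'[of real_bump_map "y / 2" y X] assms by auto
  then show ?thesis using assms that[of x] by simp
qed

lemma real_bump_map_ge: "0 \<le> x \<Longrightarrow> x \<le> real_bump_map x"
  using real_bump_map_diff_ge[of 0 x] by (simp add: real_bump_map_0)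

text \<open>The first bound, from x \<le> F(x) \<le> 2x, loses only a constant factor. The second is
  sharp at x = y: with p the ratio of the values, it follows from y/x \<le> 2p - 1 \<le>
  p^2.\<close>

lemma ratio_le_real_bump_map_ratio:
  assumes "0 < x" "x \<le> y"
  shows "y / x \<le> 2 * (real_bump_map y / real_bump_map x)"
    and "y / x \<le> (real_bump_map y / real_bump_map x)\<^sup>2"
proof -
  define p where "p = real_bump_map y / real_bump_map x"
  have x: "x \<le> real_bump_map x" "real_bump_map x \<le> 2 * x" "0 < real_bump_map x"
    using real_bump_map_ge[of x] real_bump_map_le[of x] assms by auto
  have "real_bump_map x * y \<le> (2 * x) * real_bump_map y"
    using x real_bump_map_ge[of y] assms by (intro mult_mono) auto
  then show "y / x \<le> 2 * (real_bump_map y / real_bump_map x)"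
    using x assms by (simp add: field_simps)
  have d: "y - x \<le> real_bump_map y - real_bump_map x"
    using real_bump_map_diff_ge[of x y] assms by auto
  have "y / x - 1 = (y - x) / x"
    using assms by (simp add: field_simps)
  also have "\<dots> \<le> (real_bump_map y - real_bump_map x) / (real_bump_map x / 2)"
    using d x assms by (intro frac_le) auto
  also have "\<dots> = 2 * (p - 1)"
    using x by (simp add: p_def field_simps)
  finally have "y / x \<le> 2 * p - 1" by simp
  also have "\<dots> \<le> p\<^sup>2"
    using zero_le_power2[of "p - 1"] by (simp add: power2_eq_square algebra_simps)
  finally show "y / x \<le> (real_bump_map y / real_bump_map x)\<^sup>2"
    by (simp add: p_def)
qed

section \<open>From the pinched region to the almost-geodesic\<close>

text \<open>With a_k between |z| and 2|z|, the modulus of F(z) is at most 2|z| \<le> 2 a_k, so the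
  left side is at most 2|z| \<omega>(2 a_k). The factor 16 in \<open>c k\<close> makes this equal to
  C times the gain c_k |z| / 8 of \<open>Re_bump_map_ge\<close>; strictness comes from Re z >
  0.\<close>

lemma bump_map_pinched:
  assumes a: "\<And>k. a k = R / 2 ^ k" and c: "\<And>k. c k = 16 * \<omega> (2 * a k) / C" and C: "0 < C"
    and \<omega>: "mono_on {0..<e} \<omega>" "2 * R < e"
    and z: "0 < Re z" "cmod z < R"
  shows "cmod (bump_map c a z) * \<omega> (cmod (bump_map c a z)) < C * Re (bump_map c a z)"
proof -
  have "0 < cmod z" using z by auto
  then obtain k where k: "cmod z \<le> a k" "a k \<le> 2 * cmod z"
    using dyadic_scale_exists[OF _ z(2)] a by auto
  have le: "cmod (bump_map c a z) \<le> 2 * cmod z"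
    using z by (intro norm_bump_map_le) auto
  have "0 \<le> R" using z(2) \<open>0 < cmod z\<close> by linarith
  then have "a k \<le> R"
    using mult_left_mono[of 1 "2 ^ k" R] by (simp add: a divide_le_eq)
  then have "\<omega> (cmod (bump_map c a z)) \<le> \<omega> (2 * a k)"
    using le k \<omega>(2) by (intro mono_onD[OF \<omega>(1)]) auto
  moreover have "0 \<le> \<omega> (2 * a k)"
    using c_nonneg[of k] c C by (simp add: zero_le_divide_iff)
  ultimately have "cmod (bump_map c a z) * \<omega> (cmod (bump_map c a z)) \<le> (2 * cmod z) * \<omega> (2 * a k)"
    using le mult_left_mono[of "\<omega> (cmod (bump_map c a z))" "\<omega> (2 * a k)" "cmod (bump_map c a z)"]
      mult_right_mono[of "cmod (bump_map c a z)" "2 * cmod z" "\<omega> (2 * a k)"] by simp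
  also have "\<dots> < C * (Re z + c k * cmod z / 8)"
    using C z by (simp add: c distrib_left)
  also have "\<dots> \<le> C * Re (bump_map c a z)"
    using Re_bump_map_ge[of z k] z k C by (intro mult_left_mono) auto
  finally show ?thesis .
qed

text \<open>The affine map w -> (R/2)(1 - w) carries the unit disc onto the disc with centre and
  radius R/2. That disc lies in the right half plane, has modulus below R throughout, and touches 0,
  which corresponds to w = 1.\<close>

lemma holomorphic_disc_bump_map:
  fixes \<eta> :: "complex ^ 'n"
  assumes R: "0 < R" and sub: "\<And>z. 0 < Re z \<Longrightarrow> cmod z < R \<Longrightarrow> \<xi> + bump_map c a z *s \<eta> \<in> \<Omega>"
  shows "holomorphic_disc \<Omega> (\<lambda>w. \<xi> + bump_map c a (of_real (R / 2) * (1 - w)) *s \<eta>)"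
  unfolding holomorphic_disc_def
proof (intro conjI allI subsetI)
  define h where "h w = of_real (R / 2) * (1 - w)" for w :: complex
  have h: "0 < Re (h z)" "cmod (h z) < R" if "cmod z < 1" for z
  proof -
    have "Re z < 1" using that complex_Re_le_cmod[of z] by linarith
    then show "0 < Re (h z)" using R by (simp add: h_def)
    have "cmod (1 - z) < 2" using that norm_triangle_ineq4[of 1 z] by simp
    then show "cmod (h z) < R"
      using R by (simp add: h_def norm_mult)
  qed
  have "(bump_map c a \<circ> h) holomorphic_on ball 0 1"
    using h unfolding h_def
    by (intro holomorphic_on_compose_gen[OF _ bump_map_holomorphic] holomorphic_intros) auto
  then have "(\<lambda>z. bump_map c a (of_real (R / 2) * (1 - z))) holomorphic_on ball 0 1"
    by (simp add: o_def h_def)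
  then show "(\<lambda>z. (\<xi> + bump_map c a (of_real (R / 2) * (1 - z)) *s \<eta>) $ i) holomorphic_on ball 0 1" for i
    unfolding vector_add_component vector_smult_component by (intro holomorphic_intros)
  fix x assume "x \<in> (\<lambda>w. \<xi> + bump_map c a (of_real (R / 2) * (1 - w)) *s \<eta>) ` ball 0 1"
  then show "x \<in> \<Omega>"
    using sub h by (auto simp: h_def)
qed

text \<open>The half space gives the lower bound without loss; the disc through the normal gives the
  upper bounds. The constant 4 serves both as Lipschitz constant and, through ln 2 \<le> ln 4, for
  the additive error.\<close>

lemma almost_geodesic_normal:
  fixes \<eta> :: "complex ^ 'n"
  assumes R: "0 < R" and sub: "\<And>z. 0 < Re z \<Longrightarrow> cmod z < R \<Longrightarrow> \<xi> + bump_map c a z *s \<eta> \<in> \<Omega>"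
    and half: "\<And>x. x \<in> \<Omega> \<Longrightarrow> 0 < inner (x - \<xi>) \<eta>" and \<eta>: "norm \<eta> = 1"
  shows "almost_geodesic \<Omega> 4 {0..} (\<lambda>t. \<xi> + (R / 2 * exp (- 2 * t)) *\<^sub>R \<eta>)"
proof -
  define f where "f = (\<lambda>z. \<xi> + bump_map c a (of_real (R / 2) * (1 - z)) *s \<eta>)"
  define y where "y t = R / 2 * exp (- 2 * t)" for t :: real
  define \<sigma> where "\<sigma> t = \<xi> + y t *\<^sub>R \<eta>" for t
  have disc: "holomorphic_disc \<Omega> f"
    unfolding f_def by (rule holomorphic_disc_bump_map[OF R sub])
  \<comment> \<open>Solving F(x) = y(t) on the axis yields a real parameter \<open>b t\<close> in
    the disc that \<open>f\<close> sends to the point of the curve at time \<open>t\<close>.\<close>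
  have "\<exists>x. 0 < x \<and> x \<le> R / 2 \<and> real_bump_map x = y t" if "0 \<le> t" for t
    using real_bump_map_surj[of "y t" "R / 2"] that R by (auto simp: y_def)
  then obtain X where X: "\<And>t. 0 \<le> t \<Longrightarrow> 0 < X t \<and> X t \<le> R / 2 \<and> real_bump_map (X t) = y t"
    by metis
  define u where "u t = X t / (R / 2)" for t
  define b where "b t = (of_real (1 - u t) :: complex)" for t
  have u: "0 < u t" "u t \<le> 1" if "0 \<le> t" for t
    using X[OF that] R by (auto simp: u_def)
  have b: "b t \<in> ball 0 1" if "0 \<le> t" for t
    using u[OF that] unfolding b_def by (simp del: of_real_diff)
  have f_b: "f (b t) = \<sigma> t" if "0 \<le> t" for t
  proof -
    have "of_real (R / 2) * (1 - b t) = of_real (X t)"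
      using R by (simp add: b_def u_def)
    then have "f (b t) = \<xi> + of_real (y t) *s \<eta>"
      using X[OF that] by (simp add: f_def bump_map_of_real)
    also have "\<dots> = \<sigma> t"
      using vector_scalar_mult_complex_split[of "of_real (y t)" \<eta>] by (simp add: \<sigma>_def)
    finally show ?thesis .
  qed
  have mono: "X t \<le> X s" if "0 \<le> s" "s \<le> t" for s t
  proof (rule ccontr)
    assume "\<not> ?thesis"
    then have "0 < y t - y s"
      using real_bump_map_diff_ge[of "X s" "X t"] X[of s] X[of t] that by auto
    then show False using that R by (simp add: y_def)
  qed
  have upper: "poincare_dist (b t) (b s) \<le> (t - s) + ln 2" "poincare_dist (b t) (b s) \<le> 4 * (t - s)"
    if st: "0 \<le> s" "s \<le> t" for s t
  proof -
    have t: "0 \<le> t" using st by simp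
    have uts: "0 < u t" "u t \<le> u s" "u s \<le> 1"
      using u[OF st(1)] u[OF t] mono[OF st] R by (auto simp: u_def divide_right_mono)
    define q where "q = u s / u t"
    have q: "q = X s / X t" "0 < q"
      using R X[OF st(1)] X[OF t] by (auto simp: q_def u_def)
    have "y s / y t = exp (2 * (t - s))"
      using R by (simp add: y_def algebra_simps flip: exp_diff)
    then have p: "real_bump_map (X s) / real_bump_map (X t) = exp (2 * (t - s))"
      using X[OF st(1)] X[OF t] by metis
    \<comment> \<open>The first bound will give t - s + ln 2, the second the Lipschitz constant
      4.\<close>
    have "q \<le> 2 * exp (2 * (t - s))" "q \<le> (exp (2 * (t - s)))\<^sup>2"
      using ratio_le_real_bump_map_ratio[of "X t" "X s"] X[OF t] mono[OF st] unfolding p q by auto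
    then have "ln (2 * q) \<le> ln (4 * exp (2 * (t - s)))" "ln q \<le> ln ((exp (2 * (t - s)))\<^sup>2)"
      using q by (intro ln_mono; simp)+
    moreover have "ln (4 * exp (2 * (t - s))) = 2 * ln 2 + 2 * (t - s)"
      using ln_realpow[of 2 2] by (simp add: ln_mult_pos)
    ultimately have "ln (2 * q) \<le> 2 * ln 2 + 2 * (t - s)" "ln q \<le> 4 * (t - s)"
      by (simp_all add: ln_realpow)
    then show "poincare_dist (b t) (b s) \<le> (t - s) + ln 2" "poincare_dist (b t) (b s) \<le> 4 * (t - s)"
      using poincare_dist_real_le[OF uts] unfolding b_def q_def by auto
  qed
  have kob: "\<bar>s - t\<bar> - ln 4 \<le> kobayashi_dist \<Omega> (\<sigma> s) (\<sigma> t) \<and>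
      kobayashi_dist \<Omega> (\<sigma> s) (\<sigma> t) \<le> \<bar>s - t\<bar> + ln 4 \<and>
      kobayashi_dist \<Omega> (\<sigma> s) (\<sigma> t) \<le> 4 * \<bar>s - t\<bar>" if "0 \<le> s" "0 \<le> t" for s t
  proof -
    have "kobayashi_dist \<Omega> (\<sigma> s) (\<sigma> t) \<le> poincare_dist (b s) (b t)"
      using kobayashi_dist_le_poincare_dist[OF disc b[OF that(1)] b[OF that(2)]] f_b that by simp
    moreover have "poincare_dist (b s) (b t) \<le> \<bar>s - t\<bar> + ln 2 \<and> poincare_dist (b s) (b t) \<le> 4 * \<bar>s - t\<bar>"
      using upper[of s t] upper[of t s] that poincare_dist_commute[of "b s" "b t"]
      by (cases "s \<le> t") auto
    moreover have "ln 2 \<le> ln (4::real)" "0 \<le> ln (4::real)"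
      by auto
    moreover have "\<bar>s - t\<bar> \<le> kobayashi_dist \<Omega> (\<sigma> s) (\<sigma> t)"
    proof -
      \<comment> \<open>The height is exactly exponential with rate 2, which cancels the factor 1/2
        in the half-space bound.\<close>
      have "ln (inner (\<sigma> s - \<xi>) \<eta>) = ln (R / 2) - 2 * s" for s
      proof -
        have eq: "inner (\<sigma> s - \<xi>) \<eta> = R / 2 * exp (- 2 * s)"
          using \<eta> by (simp add: \<sigma>_def y_def dot_square_norm)
        show ?thesis
          unfolding eq using R ln_mult_pos[of "R / 2" "exp (- 2 * s)"] by simp
      qed
      moreover have "kobayashi_chain \<Omega> (\<sigma> s) (\<sigma> t) 1 (\<lambda>_. f) (\<lambda>_. b s) (\<lambda>_. b t)"
        using kobayashi_chain_of_disc[OF disc b[OF that(1)] b[OF that(2)]] f_b that by simp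
      note kobayashi_dist_ge_half_space[OF half this]
      ultimately show ?thesis
        by (auto simp: abs_if split: if_splits)
    qed
    ultimately show ?thesis by linarith
  qed
  have "\<sigma> t \<in> \<Omega>" if "0 \<le> t" for t
    using disc b[OF that] f_b[OF that] unfolding holomorphic_disc_def by (metis image_subset_iff)
  then show ?thesis
    using kob is_interval_ci[of 0] unfolding almost_geodesic_def \<sigma>_def y_def by auto
qed

end

section \<open>The normal of a region with gradient\<close>

text \<open>Riesz representation in coordinates; a finite sum of evaluations of the derivative keeps
  continuity.\<close>

lemma C1_on_gradient:
  fixes \<rho> :: "'a::euclidean_space \<Rightarrow> real"
  assumes "C1_on U \<rho>"
  obtains g where "continuous_on U g" "\<And>x. x \<in> U \<Longrightarrow> (\<rho> has_derivative (\<lambda>v. g x \<bullet> v)) (at x)"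
proof -
  obtain \<rho>' :: "'a \<Rightarrow> 'a \<Rightarrow>\<^sub>L real" where
    d: "\<And>x. x \<in> U \<Longrightarrow> (\<rho> has_derivative blinfun_apply (\<rho>' x)) (at x)" and c: "continuous_on U \<rho>'"
    using assms by (auto simp: C1_on_def)
  define g where "g x = (\<Sum>b\<in>Basis. blinfun_apply (\<rho>' x) b *\<^sub>R b)" for x
  have "g x \<bullet> v = blinfun_apply (\<rho>' x) v" for x v
  proof -
    have "blinfun_apply (\<rho>' x) v = blinfun_apply (\<rho>' x) (\<Sum>b\<in>Basis. (v \<bullet> b) *\<^sub>R b)"
      by (simp add: euclidean_representation)
    also have "\<dots> = (\<Sum>b\<in>Basis. (v \<bullet> b) * blinfun_apply (\<rho>' x) b)"
      by (simp add: blinfun.sum_right blinfun.scaleR_right)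
    finally show ?thesis
      unfolding g_def inner_sum_left by (simp add: inner_commute mult.commute)
  qed
  moreover have "continuous_on U g"
    unfolding g_def using c by (intro continuous_intros)
  ultimately show ?thesis using d that[of g] by simp
qed

locale gradient_region =
  fixes \<Omega> U :: "'a::euclidean_space set" and \<rho> :: "'a \<Rightarrow> real" and g :: "'a \<Rightarrow> 'a"
  assumes open_U: "open U" and frontier_subset: "frontier \<Omega> \<subseteq> U"
    and neg_iff: "\<Omega> \<inter> U = {x \<in> U. \<rho> x < 0}"
    and zero_iff: "frontier \<Omega> \<inter> U = {x \<in> U. \<rho> x = 0}"
    and has_gradient: "x \<in> U \<Longrightarrow> (\<rho> has_derivative (\<lambda>v. g x \<bullet> v)) (at x)"
    and continuous_gradient: "continuous_on U g"
    and gradient_nonzero: "x \<in> frontier \<Omega> \<Longrightarrow> g x \<noteq> 0"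
begin

lemma rho_frontier: "\<xi> \<in> frontier \<Omega> \<Longrightarrow> \<rho> \<xi> = 0"
  using frontier_subset zero_iff by blast

lemma line_derivative:
  assumes "x + t *\<^sub>R v \<in> U"
  shows "((\<lambda>t. \<rho> (x + t *\<^sub>R v)) has_real_derivative (g (x + t *\<^sub>R v) \<bullet> v)) (at t)"
proof -
  have "((\<lambda>t. \<rho> (x + t *\<^sub>R v)) has_derivative (\<lambda>s. g (x + t *\<^sub>R v) \<bullet> (s *\<^sub>R v))) (at t)"
    by (rule has_derivative_compose[where f = "\<lambda>t. x + t *\<^sub>R v", OF _ has_gradient[OF assms]])
      (auto intro!: derivative_eq_intros)
  then show ?thesis
    by (simp add: has_field_derivative_def mult_commute_abs)
qed

lemma dir_deriv_eq:
  assumes "x \<in> U"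
  shows "dir_deriv v \<rho> x = g x \<bullet> v"
  unfolding dir_deriv_def using line_derivative[of x 0 v] assms by (intro DERIV_imp_deriv) simp

lemma line_eventually_in_U:
  assumes "\<xi> \<in> frontier \<Omega>"
  obtains d where "0 < d" "\<And>t. \<bar>t\<bar> < d \<Longrightarrow> \<xi> + t *\<^sub>R v \<in> U"
proof -
  have "open ((\<lambda>t. \<xi> + t *\<^sub>R v) -` U)"
    using open_U by (intro open_vimage continuous_intros)
  moreover have "0 \<in> (\<lambda>t::real. \<xi> + t *\<^sub>R v) -` U"
    using assms frontier_subset by auto
  ultimately obtain d where "0 < d" "ball 0 d \<subseteq> (\<lambda>t::real. \<xi> + t *\<^sub>R v) -` U"
    unfolding open_contains_ball by blast
  then show ?thesis using that[of d] by (auto simp: subset_iff)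
qed

section \<open>First-order geometry of the boundary: tangent space and normal\<close>

text \<open>A positive derivative makes \<rho> positive just after \<xi>, and points of
  \<open>U\<close> with \<rho> > 0 belong neither to \<Omega> nor to its frontier.\<close>

lemma outward_direction:
  assumes \<xi>: "\<xi> \<in> frontier \<Omega>" and v: "0 < g \<xi> \<bullet> v"
  obtains d where "0 < d" "\<And>t. 0 < t \<Longrightarrow> t < d \<Longrightarrow> \<xi> + t *\<^sub>R v \<notin> closure \<Omega>"
proof -
  obtain d where d: "0 < d" "\<And>t. \<bar>t\<bar> < d \<Longrightarrow> \<xi> + t *\<^sub>R v \<in> U"
    using line_eventually_in_U[OF \<xi>] by blast
  have \<xi>U: "\<xi> + 0 *\<^sub>R v \<in> U" using \<xi> frontier_subset by auto
  obtain e where e: "0 < e" "\<And>t. 0 < t \<Longrightarrow> t < e \<Longrightarrow> \<rho> \<xi> < \<rho> (\<xi> + t *\<^sub>R v)"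
    using DERIV_pos_inc_right[OF line_derivative[OF \<xi>U]] v by auto
  show ?thesis
  proof (rule that[of "min d e"])
    fix t assume t: "0 < t" "t < min d e"
    then have "\<xi> + t *\<^sub>R v \<in> U" "0 < \<rho> (\<xi> + t *\<^sub>R v)"
      using d e rho_frontier[OF \<xi>] by auto
    then show "\<xi> + t *\<^sub>R v \<notin> closure \<Omega>"
      using neg_iff zero_iff closure_Un_frontier[of \<Omega>] by force
  qed (use d e in auto)
qed

lemma inward_direction:
  assumes \<xi>: "\<xi> \<in> frontier \<Omega>" and v: "g \<xi> \<bullet> v < 0"
  obtains d where "0 < d" "\<And>t. 0 < t \<Longrightarrow> t < d \<Longrightarrow> \<xi> + t *\<^sub>R v \<in> \<Omega>"
proof -
  obtain d where d: "0 < d" "\<And>t. \<bar>t\<bar> < d \<Longrightarrow> \<xi> + t *\<^sub>R v \<in> U"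
    using line_eventually_in_U[OF \<xi>] by blast
  have \<xi>U: "\<xi> + 0 *\<^sub>R v \<in> U" using \<xi> frontier_subset by auto
  obtain e where e: "0 < e" "\<And>t. 0 < t \<Longrightarrow> t < e \<Longrightarrow> \<rho> (\<xi> + t *\<^sub>R v) < \<rho> \<xi>"
    using DERIV_neg_dec_right[OF line_derivative[OF \<xi>U]] v by auto
  show ?thesis
  proof (rule that[of "min d e"])
    fix t assume t: "0 < t" "t < min d e"
    then have "\<xi> + t *\<^sub>R v \<in> U" "\<rho> (\<xi> + t *\<^sub>R v) < 0"
      using d e rho_frontier[OF \<xi>] by auto
    then show "\<xi> + t *\<^sub>R v \<in> \<Omega>"
      using neg_iff by blast
  qed (use d e in auto)
qed

text \<open>Tilting \<open>v\<close> by a multiple \<open>w\<close> of the gradient with norm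
  \<open>e\<close> gives one ray outside the closure and one inside \<Omega>. At time
  \<open>t\<close> the segment joining them stays within e t of the tangent point and must cross the
  frontier.\<close>

lemma frontier_near_tangent:
  assumes \<xi>: "\<xi> \<in> frontier \<Omega>" and v: "g \<xi> \<bullet> v = 0" and e: "0 < e"
  obtains d where "0 < d"
    "\<And>t. 0 < t \<Longrightarrow> t < d \<Longrightarrow> \<exists>y\<in>frontier \<Omega>. dist (\<xi> + t *\<^sub>R v) y \<le> e * t"
proof -
  define w where "w = (e / norm (g \<xi>)) *\<^sub>R g \<xi>"
  have gw: "0 < g \<xi> \<bullet> w"
    using gradient_nonzero[OF \<xi>] e by (simp add: w_def)
  have norm_w: "norm w = e"
    using gradient_nonzero[OF \<xi>] e by (simp add: w_def)
  obtain d1 where d1: "0 < d1" "\<And>t. 0 < t \<Longrightarrow> t < d1 \<Longrightarrow> \<xi> + t *\<^sub>R (v + w) \<notin> closure \<Omega>"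
    using outward_direction[OF \<xi>, of "v + w"] v gw by (auto simp: inner_add_right)
  obtain d2 where d2: "0 < d2" "\<And>t. 0 < t \<Longrightarrow> t < d2 \<Longrightarrow> \<xi> + t *\<^sub>R (v - w) \<in> \<Omega>"
    using inward_direction[OF \<xi>, of "v - w"] v gw by (auto simp: inner_diff_right)
  show ?thesis
  proof (rule that[of "min d1 d2"])
    fix t assume t: "0 < t" "t < min d1 d2"
    define p q where "p = \<xi> + t *\<^sub>R (v + w)" and "q = \<xi> + t *\<^sub>R (v - w)"
    have "closed_segment p q \<inter> \<Omega> \<noteq> {}" "closed_segment p q - \<Omega> \<noteq> {}"
      using d1(2)[of t] d2(2)[of t] t closure_subset[of \<Omega>] by (auto simp: p_def q_def)
    then obtain y where y: "y \<in> closed_segment p q" "y \<in> frontier \<Omega>"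
      using connected_Int_frontier[of "closed_segment p q" \<Omega>] by auto
    have "p \<in> cball (\<xi> + t *\<^sub>R v) (e * t)" "q \<in> cball (\<xi> + t *\<^sub>R v) (e * t)"
      using t by (auto simp: p_def q_def dist_norm algebra_simps norm_w)
    then have "closed_segment p q \<subseteq> cball (\<xi> + t *\<^sub>R v) (e * t)"
      by (intro closed_segment_subset) auto
    then show "\<exists>y\<in>frontier \<Omega>. dist (\<xi> + t *\<^sub>R v) y \<le> e * t"
      using y by (intro bexI[of _ y]) (auto simp: subset_iff)
  qed (use d1 d2 in auto)
qed

text \<open>One inclusion differentiates \<rho> = 0 along the curve. For the other, nearest frontier
  points to the tangent line are at distance o(t) by \<open>frontier_near_tangent\<close>.\<close>

lemma tangent_space_frontier:
  assumes \<xi>: "\<xi> \<in> frontier \<Omega>"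
  shows "tangent_space (frontier \<Omega>) \<xi> = {v. g \<xi> \<bullet> v = 0}"
proof (intro equalityI subsetI CollectI)
  fix v assume "v \<in> tangent_space (frontier \<Omega>) \<xi>"
  then obtain \<gamma> where \<gamma>: "\<gamma> ` {-1<..<1} \<subseteq> frontier \<Omega>" "\<gamma> 0 = \<xi>"
    "(\<gamma> has_derivative (\<lambda>t. t *\<^sub>R v)) (at (0::real))"
    by (auto simp: tangent_space_def has_vector_derivative_def)
  have "((\<lambda>t. \<rho> (\<gamma> t)) has_derivative (\<lambda>t. g \<xi> \<bullet> (t *\<^sub>R v))) (at 0)"
    using has_derivative_compose[OF \<gamma>(3), of \<rho> "\<lambda>v. g \<xi> \<bullet> v"] has_gradient \<gamma>(2) \<xi> frontier_subset by auto
  then have "((\<lambda>t. 0) has_derivative (\<lambda>t. g \<xi> \<bullet> (t *\<^sub>R v))) (at 0)"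
    by (rule has_derivative_transform_within_open[of _ _ 0 UNIV "{-1<..<1}"])
      (use \<gamma>(1) rho_frontier in \<open>auto simp: image_subset_iff\<close>)
  then have "(\<lambda>t. g \<xi> \<bullet> (t *\<^sub>R v)) = (\<lambda>t. 0)"
    using has_derivative_unique has_derivative_const by blast
  from fun_cong[OF this, of 1] show "g \<xi> \<bullet> v = 0" by simp
next
  fix v assume "v \<in> {v. g \<xi> \<bullet> v = 0}"
  then have v: "g \<xi> \<bullet> v = 0" by simp
  \<comment> \<open>No implicit function theorem: a curve in \<open>tangent_space\<close> need only be differentiable at 0.\<close>
  define \<gamma> where "\<gamma> t = closest_point (frontier \<Omega>) (\<xi> + t *\<^sub>R v)" for t :: real
  have ne: "closed (frontier \<Omega>)" "frontier \<Omega> \<noteq> {}"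
    using \<xi> by auto
  have \<gamma>_in: "\<gamma> t \<in> frontier \<Omega>" for t
    unfolding \<gamma>_def using ne by (rule closest_point_in_set)
  have \<gamma>0: "\<gamma> 0 = \<xi>"
    using \<xi> by (simp add: \<gamma>_def closest_point_self)
  have "(\<gamma> has_derivative (\<lambda>t. t *\<^sub>R v)) (at 0)"
    unfolding has_derivative_at_alt
  proof (intro conjI allI impI)
    fix e :: real assume e: "0 < e"
    obtain d1 where d1: "0 < d1" "\<And>t. 0 < t \<Longrightarrow> t < d1 \<Longrightarrow> \<exists>y\<in>frontier \<Omega>. dist (\<xi> + t *\<^sub>R v) y \<le> e * t"
      using frontier_near_tangent[OF \<xi> v e] by blast
    \<comment> \<open>The direction \<open>- v\<close> covers negative times.\<close>
    obtain d2 where d2: "0 < d2" "\<And>t. 0 < t \<Longrightarrow> t < d2 \<Longrightarrow> \<exists>y\<in>frontier \<Omega>. dist (\<xi> + t *\<^sub>R (- v)) y \<le> e * t"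
      using frontier_near_tangent[OF \<xi> _ e, of "- v"] v by auto
    have "norm (\<gamma> t - \<gamma> 0 - (t - 0) *\<^sub>R v) \<le> e * norm (t - 0)" if "norm (t - 0) < min d1 d2" for t
    proof (cases "t = 0")
      case False
      then have "\<exists>y\<in>frontier \<Omega>. dist (\<xi> + t *\<^sub>R v) y \<le> e * \<bar>t\<bar>"
        using d1(2)[of t] d2(2)[of "- t"] that by (cases "0 < t") auto
      then obtain y where y: "y \<in> frontier \<Omega>" "dist (\<xi> + t *\<^sub>R v) y \<le> e * \<bar>t\<bar>" by blast
      then have "dist (\<xi> + t *\<^sub>R v) (\<gamma> t) \<le> e * \<bar>t\<bar>"
        unfolding \<gamma>_def using closest_point_le[OF ne(1) y(1), of "\<xi> + t *\<^sub>R v"] y(2) by linarith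
      then show ?thesis
        by (simp add: \<gamma>0 dist_norm norm_minus_commute algebra_simps)
    qed simp
    then show "\<exists>d>0. \<forall>t. norm (t - 0) < d \<longrightarrow> norm (\<gamma> t - \<gamma> 0 - (t - 0) *\<^sub>R v) \<le> e * norm (t - 0)"
      using d1(1) d2(1) by (intro exI[of _ "min d1 d2"]) auto
  qed (rule bounded_linear_scaleR_left)
  then show "v \<in> tangent_space (frontier \<Omega>) \<xi>"
    unfolding tangent_space_def has_vector_derivative_def using \<gamma>_in \<gamma>0
    by (intro CollectI exI[of _ \<gamma>]) (simp add: image_subset_iff)
qed

text \<open>Orthogonality to the kernel of the gradient forces \<eta> = k g; a positive k would lead
  out of the closure, and unit length then fixes k.\<close>

lemma inward_normal_eq:
  assumes \<xi>: "\<xi> \<in> frontier \<Omega>"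
  shows "inward_normal \<Omega> \<xi> = - (g \<xi> /\<^sub>R norm (g \<xi>))"
  unfolding inward_normal_def tangent_space_frontier[OF \<xi>]
proof (rule the_equality)
  let ?n = "- (g \<xi> /\<^sub>R norm (g \<xi>))"
  have g: "g \<xi> \<noteq> 0" by (rule gradient_nonzero[OF \<xi>])
  have "g \<xi> \<bullet> ?n < 0"
    using g by simp
  then obtain d where "0 < d" "\<And>t. 0 < t \<Longrightarrow> t < d \<Longrightarrow> \<xi> + t *\<^sub>R ?n \<in> \<Omega>"
    using inward_direction[OF \<xi>] by blast
  then show "norm ?n = 1 \<and> (\<forall>v\<in>{v. g \<xi> \<bullet> v = 0}. ?n \<bullet> v = 0) \<and> (\<exists>\<delta>>0. \<forall>t. 0 < t \<and> t < \<delta> \<longrightarrow> \<xi> + t *\<^sub>R ?n \<in> \<Omega>)"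
    using g by auto
  fix \<eta> assume "norm \<eta> = 1 \<and> (\<forall>v\<in>{v. g \<xi> \<bullet> v = 0}. \<eta> \<bullet> v = 0) \<and> (\<exists>\<delta>>0. \<forall>t. 0 < t \<and> t < \<delta> \<longrightarrow> \<xi> + t *\<^sub>R \<eta> \<in> \<Omega>)"
  then obtain \<delta> where \<eta>: "norm \<eta> = 1" "\<And>v. g \<xi> \<bullet> v = 0 \<Longrightarrow> \<eta> \<bullet> v = 0"
    and \<delta>: "0 < \<delta>" "\<And>t. 0 < t \<Longrightarrow> t < \<delta> \<Longrightarrow> \<xi> + t *\<^sub>R \<eta> \<in> \<Omega>" by auto
  \<comment> \<open>The coefficient of the orthogonal projection onto the gradient; the remainder is
    orthogonal to itself.\<close>
  define k where "k = \<eta> \<bullet> g \<xi> / (g \<xi> \<bullet> g \<xi>)"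
  have "g \<xi> \<bullet> (\<eta> - k *\<^sub>R g \<xi>) = 0"
    using g by (simp add: k_def inner_diff_right inner_commute)
  moreover from this have "\<eta> \<bullet> (\<eta> - k *\<^sub>R g \<xi>) = 0" by (rule \<eta>(2))
  ultimately have "(\<eta> - k *\<^sub>R g \<xi>) \<bullet> (\<eta> - k *\<^sub>R g \<xi>) = 0"
    by (simp add: inner_diff_left)
  then have eq: "\<eta> = k *\<^sub>R g \<xi>" by simp
  have "\<not> 0 < k"
  proof
    assume "0 < k"
    then have "0 < g \<xi> \<bullet> \<eta>" using g eq by simp
    then obtain d where d: "0 < d" "\<And>t. 0 < t \<Longrightarrow> t < d \<Longrightarrow> \<xi> + t *\<^sub>R \<eta> \<notin> closure \<Omega>"
      using outward_direction[OF \<xi>] by blast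
    define t where "t = min d \<delta> / 2"
    have "0 < t" "t < d" "t < \<delta>" using d(1) \<delta>(1) by (auto simp: t_def)
    with d(2)[of t] \<delta>(2)[of t] closure_subset[of \<Omega>] show False by blast
  qed
  then have "- k * norm (g \<xi>) = 1" using \<eta>(1) eq by simp
  then have "k = - (1 / norm (g \<xi>))" using g by (simp add: field_simps)
  then show "\<eta> = ?n" using eq by (simp add: divide_inverse)
qed

lemma norm_inward_normal: "\<xi> \<in> frontier \<Omega> \<Longrightarrow> norm (inward_normal \<Omega> \<xi>) = 1"
  using gradient_nonzero[of \<xi>] by (simp add: inward_normal_eq)

lemma gradient_inner_eq:
  "\<xi> \<in> frontier \<Omega> \<Longrightarrow> g \<xi> \<bullet> v = - norm (g \<xi>) * (inward_normal \<Omega> \<xi> \<bullet> v)"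
  using gradient_nonzero[of \<xi>] by (simp add: inward_normal_eq)

section \<open>Supporting half spaces and uniform decrease along normals\<close>

text \<open>Otherwise \<Omega> would contain a point \<open>y\<close> strictly on the outer side.
  The segment from \<xi> to \<open>y\<close> would leave the closure at once, although the closure
  is convex.\<close>

lemma convex_in_half_space:
  assumes "convex \<Omega>" "open \<Omega>" and \<xi>: "\<xi> \<in> frontier \<Omega>" and x: "x \<in> \<Omega>"
  shows "0 < (x - \<xi>) \<bullet> inward_normal \<Omega> \<xi>"
proof (rule ccontr)
  define \<eta> where "\<eta> = inward_normal \<Omega> \<xi>"
  assume "\<not> ?thesis"
  then have le: "\<eta> \<bullet> (x - \<xi>) \<le> 0" by (simp add: \<eta>_def inner_commute)
  have [simp]: "\<eta> \<bullet> \<eta> = 1"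
    using norm_inward_normal[OF \<xi>] by (simp add: \<eta>_def dot_square_norm)
  obtain e where e: "0 < e" "ball x e \<subseteq> \<Omega>"
    using \<open>open \<Omega>\<close> x open_contains_ball by blast
  \<comment> \<open>Openness allows this shift, which turns the weak inequality into a strict
    one.\<close>
  define y where "y = x - (e / 2) *\<^sub>R \<eta>"
  have y: "y \<in> \<Omega>"
    using e norm_inward_normal[OF \<xi>] by (intro subsetD[OF e(2)]) (simp add: y_def dist_norm \<eta>_def)
  have "\<eta> \<bullet> (y - \<xi>) < 0"
    using le e(1) by (simp add: y_def algebra_simps)
  then have "0 < g \<xi> \<bullet> (y - \<xi>)"
    using gradient_nonzero[OF \<xi>] gradient_inner_eq[OF \<xi>, of "y - \<xi>"] by (simp add: \<eta>_def mult_pos_neg)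
  then obtain d where d: "0 < d" "\<And>t. 0 < t \<Longrightarrow> t < d \<Longrightarrow> \<xi> + t *\<^sub>R (y - \<xi>) \<notin> closure \<Omega>"
    using outward_direction[OF \<xi>] by blast
  define t where "t = min (d / 2) 1"
  have t: "0 < t" "t < d" "t \<le> 1" using d(1) by (auto simp: t_def)
  have "\<xi> \<in> closure \<Omega>" "y \<in> closure \<Omega>"
    using \<xi> y closure_subset[of \<Omega>] by (auto simp: frontier_def)
  then have "(1 - t) *\<^sub>R \<xi> + t *\<^sub>R y \<in> closure \<Omega>"
    using convex_closure[OF \<open>convex \<Omega>\<close>] t by (intro convexD) auto
  then show False
    using d(2)[OF t(1,2)] by (simp add: algebra_simps)
qed

text \<open>On the compact frontier the gradient has norm at least 2c. Uniform continuity costs at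
  most c along a short normal, leaving slope at most -c with constants independent of \<xi>.\<close>

lemma uniform_normal_decrease:
  assumes "bounded \<Omega>" and r: "0 < r" and ball: "\<And>\<xi>. \<xi> \<in> frontier \<Omega> \<Longrightarrow> ball \<xi> r \<subseteq> U"
  obtains c d where "0 < c" "0 < d"
    "\<And>\<xi> s. \<xi> \<in> frontier \<Omega> \<Longrightarrow> 0 \<le> s \<Longrightarrow> s < d \<Longrightarrow> \<rho> (\<xi> + s *\<^sub>R inward_normal \<Omega> \<xi>) \<le> - c * s"
proof (cases "frontier \<Omega> = {}")
  case True
  then show ?thesis using that[of 1 1] by auto
next
  case False
  have cpt: "compact (frontier \<Omega>)"
    using \<open>bounded \<Omega>\<close> by (rule compact_frontier_bounded)
  moreover have "continuous_on (frontier \<Omega>) (\<lambda>x. norm (g x))"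
    using continuous_on_subset[OF continuous_gradient frontier_subset] by (intro continuous_intros)
  ultimately obtain x where "x \<in> frontier \<Omega>" and x: "\<And>\<xi>. \<xi> \<in> frontier \<Omega> \<Longrightarrow> norm (g x) \<le> norm (g \<xi>)"
    using continuous_attains_inf[OF _ False] by blast
  define c where "c = norm (g x) / 2"
  have c: "0 < c"
    using gradient_nonzero[OF \<open>x \<in> _\<close>] by (simp add: c_def)
  \<comment> \<open>Closed balls of radius r/2 make the neighbourhood compact while keeping it in
    \<open>U\<close>.\<close>
  define N where "N = (\<Union>\<xi>\<in>frontier \<Omega>. \<Union>v\<in>cball 0 (r / 2). {\<xi> + v})"
  have "compact N"
    unfolding N_def using cpt by (intro compact_sums') auto
  moreover have "N \<subseteq> U"
  proof
    fix y assume "y \<in> N"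
    then obtain \<xi> v where "\<xi> \<in> frontier \<Omega>" "norm v \<le> r / 2" "y = \<xi> + v"
      by (auto simp: N_def)
    then show "y \<in> U" using ball[of \<xi>] r by (auto simp: subset_iff dist_norm)
  qed
  ultimately have "uniformly_continuous_on N g"
    using compact_uniformly_continuous continuous_on_subset[OF continuous_gradient] by blast
  then obtain d where d: "0 < d" "\<And>y z. y \<in> N \<Longrightarrow> z \<in> N \<Longrightarrow> dist z y < d \<Longrightarrow> dist (g z) (g y) < c"
    unfolding uniformly_continuous_on_def using c by blast
  show ?thesis
  proof (rule that[of c "min d (r / 2)"])
    fix \<xi> s assume \<xi>: "\<xi> \<in> frontier \<Omega>" and s: "0 \<le> s" "s < min d (r / 2)"
    define \<eta> where "\<eta> = inward_normal \<Omega> \<xi>"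
    have n: "norm \<eta> = 1" using norm_inward_normal[OF \<xi>] by (simp add: \<eta>_def)
    have N: "\<xi> + t *\<^sub>R \<eta> \<in> N" if "0 \<le> t" "t \<le> s" for t
    proof -
      have "t *\<^sub>R \<eta> \<in> cball 0 (r / 2)" using that s n by simp
      then show ?thesis unfolding N_def using \<xi> by blast
    qed
    have deriv: "((\<lambda>t. \<rho> (\<xi> + t *\<^sub>R \<eta>) + c * t) has_real_derivative (g (\<xi> + t *\<^sub>R \<eta>) \<bullet> \<eta> + c)) (at t)"
      and le: "g (\<xi> + t *\<^sub>R \<eta>) \<bullet> \<eta> + c \<le> 0"
      if t: "0 \<le> t" "t \<le> s" for t
    proof -
      show "((\<lambda>t. \<rho> (\<xi> + t *\<^sub>R \<eta>) + c * t) has_real_derivative (g (\<xi> + t *\<^sub>R \<eta>) \<bullet> \<eta> + c)) (at t)"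
        using line_derivative[of \<xi> t \<eta>] N[OF t] \<open>N \<subseteq> U\<close>
        by (auto intro!: derivative_eq_intros)
      have "dist (\<xi> + t *\<^sub>R \<eta>) (\<xi> + 0 *\<^sub>R \<eta>) < d"
        using t s n by (simp add: dist_norm)
      then have "norm (g (\<xi> + t *\<^sub>R \<eta>) - g \<xi>) < c"
        using d(2)[OF N[of 0] N[OF t]] s by (simp add: dist_norm)
      then have "(g (\<xi> + t *\<^sub>R \<eta>) - g \<xi>) \<bullet> \<eta> \<le> c"
        using norm_cauchy_schwarz[of "g (\<xi> + t *\<^sub>R \<eta>) - g \<xi>" \<eta>] n by simp
      moreover have "g \<xi> \<bullet> \<eta> = - norm (g \<xi>)"
        using gradient_inner_eq[OF \<xi>, of \<eta>] n by (simp add: \<eta>_def dot_square_norm)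
      moreover have "2 * c \<le> norm (g \<xi>)"
        using x[OF \<xi>] by (simp add: c_def)
      ultimately show "g (\<xi> + t *\<^sub>R \<eta>) \<bullet> \<eta> + c \<le> 0"
        by (simp add: inner_diff_left)
    qed
    have "\<rho> (\<xi> + s *\<^sub>R \<eta>) + c * s \<le> \<rho> (\<xi> + 0 *\<^sub>R \<eta>) + c * 0"
      using s(1) deriv le by (intro DERIV_nonpos_imp_nonincreasing[of 0 s]) blast+
    then show "\<rho> (\<xi> + s *\<^sub>R inward_normal \<Omega> \<xi>) \<le> - c * s"
      using rho_frontier[OF \<xi>] by (simp add: \<eta>_def)
  qed (use c d r in auto)
qed

end

section \<open>Complex normal slices\<close>

text \<open>Moving from \<xi> by Re \<zeta> along \<eta> brings \<rho> down to at most -c Re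
  \<zeta>. Moving on by Im \<zeta> along i\<eta> raises it by at most |Im \<zeta>|
  \<omega>(|\<zeta>|), because that derivative vanishes at \<xi>; the hypothesis keeps the total
  negative.\<close>

lemma normal_slice_in_region:
  fixes \<Omega> U :: "(complex ^ 'n) set"
  assumes "gradient_region \<Omega> U \<rho> g" and \<xi>: "\<xi> \<in> frontier \<Omega>" and ball: "ball \<xi> r \<subseteq> U"
    and moc: "modulus_of_continuity_on_ball (dir_deriv (\<i> *s inward_normal \<Omega> \<xi>) \<rho>) \<xi> r \<omega>"
    and decr: "\<And>s. 0 \<le> s \<Longrightarrow> s < d \<Longrightarrow> \<rho> (\<xi> + s *\<^sub>R inward_normal \<Omega> \<xi>) \<le> - c * s"
    and c: "0 < c" and \<zeta>: "cmod \<zeta> < r" "cmod \<zeta> < d" "cmod \<zeta> * \<omega> (cmod \<zeta>) < c * Re \<zeta>"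
  shows "\<xi> + \<zeta> *s inward_normal \<Omega> \<xi> \<in> \<Omega>"
proof -
  interpret gradient_region \<Omega> U \<rho> g by fact
  define \<eta> where "\<eta> = inward_normal \<Omega> \<xi>"
  define D where "D = dir_deriv (\<i> *s \<eta>) \<rho>"
  define B where "B = \<omega> (cmod \<zeta>)"
  have n: "norm \<eta> = 1"
    using norm_inward_normal[OF \<xi>] by (simp add: \<eta>_def)
  have B: "0 \<le> B"
    using moc \<zeta>(1) norm_ge_zero[of \<zeta>] unfolding modulus_of_continuity_on_ball_def B_def
    by (smt (verit) atLeastLessThan_iff)
  have "0 < c * Re \<zeta>"
    using \<zeta>(3) B by (smt (verit) B_def mult_nonneg_nonneg norm_ge_zero)
  then have x: "0 < Re \<zeta>"
    using c by (simp add: zero_less_mult_iff)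
  define p where "p t = (\<xi> + Re \<zeta> *\<^sub>R \<eta>) + t *\<^sub>R (\<i> *s \<eta>)" for t
  have p: "p t \<in> ball \<xi> r" "norm (p t - \<xi>) \<le> cmod \<zeta>" if "\<bar>t\<bar> \<le> \<bar>Im \<zeta>\<bar>" for t
  proof -
    have "p t - \<xi> = Complex (Re \<zeta>) t *s \<eta>"
      by (subst vector_scalar_mult_complex_split) (simp add: p_def)
    moreover have "cmod (Complex (Re \<zeta>) t) \<le> cmod \<zeta>"
      using that by (auto simp: cmod_def abs_le_square_iff)
    ultimately show "norm (p t - \<xi>) \<le> cmod \<zeta>"
      using n by (simp add: norm_vector_scalar_mult_complex)
    then show "p t \<in> ball \<xi> r"
      using \<zeta>(1) by (simp add: dist_norm norm_minus_commute)
  qed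
  have D_\<xi>: "D \<xi> = 0"
    using dir_deriv_eq[of \<xi>] \<xi> frontier_subset gradient_inner_eq[OF \<xi>]
    by (auto simp: D_def \<eta>_def inner_i_times_self)
  have D_le: "\<bar>D (p t)\<bar> \<le> B" if t: "\<bar>t\<bar> \<le> \<bar>Im \<zeta>\<bar>" for t
  proof -
    have "\<bar>D (p t) - D \<xi>\<bar> \<le> \<omega> (norm (p t - \<xi>))"
      using moc p(1)[OF t] \<zeta>(1) unfolding modulus_of_continuity_on_ball_def D_def \<eta>_def
      by (metis centre_in_ball norm_ge_zero order_le_less_trans)
    also have "\<dots> \<le> B"
    proof -
      have "norm (p t - \<xi>) < 2 * r" "cmod \<zeta> < 2 * r"
        using p(2)[OF t] \<zeta>(1) norm_ge_zero[of \<zeta>] by linarith+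
      then show ?thesis
        using moc p(2)[OF t] unfolding modulus_of_continuity_on_ball_def B_def
        by (intro mono_onD[where f = \<omega>]) auto
    qed
    finally show ?thesis by (simp add: D_\<xi>)
  qed
  have "norm (\<rho> (p (Im \<zeta>)) - \<rho> (p 0)) \<le> B * norm (Im \<zeta> - 0)"
  \<comment> \<open>The symmetric interval treats both signs of Im \<zeta> at once.\<close>
  proof (rule field_differentiable_bound[of "{- \<bar>Im \<zeta>\<bar>..\<bar>Im \<zeta>\<bar>}" "\<lambda>t. \<rho> (p t)" "\<lambda>t. D (p t)"])
    fix t assume "t \<in> {- \<bar>Im \<zeta>\<bar>..\<bar>Im \<zeta>\<bar>}"
    then have t: "\<bar>t\<bar> \<le> \<bar>Im \<zeta>\<bar>" by auto
    show "norm (D (p t)) \<le> B"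
      using D_le[OF t] by simp
    have "p t \<in> U" using p(1)[OF t] ball by blast
    then show "((\<lambda>t. \<rho> (p t)) has_field_derivative D (p t)) (at t within {- \<bar>Im \<zeta>\<bar>..\<bar>Im \<zeta>\<bar>})"
      using line_derivative[of "\<xi> + Re \<zeta> *\<^sub>R \<eta>" t "\<i> *s \<eta>"]
      by (simp add: D_def dir_deriv_eq p_def has_field_derivative_at_within)
  qed auto
  moreover have "B * \<bar>Im \<zeta>\<bar> \<le> cmod \<zeta> * B"
    using B abs_Im_le_cmod[of \<zeta>] by (simp add: mult.commute mult_left_mono)
  moreover have "\<rho> (p 0) \<le> - c * Re \<zeta>"
    using decr[of "Re \<zeta>"] x \<zeta>(2) complex_Re_le_cmod[of \<zeta>] by (simp add: p_def \<eta>_def)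
  ultimately have "\<rho> (p (Im \<zeta>)) < 0"
    using \<zeta>(3) by (simp add: B_def)
  moreover have "p (Im \<zeta>) \<in> U"
    using p(1)[of "Im \<zeta>"] ball by auto
  ultimately have "p (Im \<zeta>) \<in> \<Omega>"
    using neg_iff by blast
  then show ?thesis
    using vector_scalar_mult_complex_split[of \<zeta> \<eta>] by (simp add: p_def \<eta>_def add.assoc)
qed

section \<open>Choice of uniform constants and conclusion\<close>

theorem proposition4p5:
  fixes \<Omega> U :: "(complex ^ 'n) set"
    and r :: real
    and \<omega> :: "real \<Rightarrow> real"
    and \<rho> :: "complex ^ 'n \<Rightarrow> real"
  assumes "open \<Omega>" and "connected \<Omega>" and "\<Omega> \<noteq> {}"
    and "bounded \<Omega>" and "convex \<Omega>" and "C1_boundary \<Omega>"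
    and "0 < r"
    and "dini_condition (2 * r) \<omega>"
    and "defining_function \<Omega> U \<rho>"
    and "\<And>\<xi>. \<xi> \<in> frontier \<Omega> \<Longrightarrow> ball \<xi> r \<subseteq> U"
    and "\<And>\<xi>. \<xi> \<in> frontier \<Omega> \<Longrightarrow>
           modulus_of_continuity_on_ball (dir_deriv (\<i> *s inward_normal \<Omega> \<xi>) \<rho>) \<xi> r \<omega>"
  shows "\<exists>K\<ge>1. \<exists>\<epsilon>>0. \<forall>\<xi> \<in> frontier \<Omega>.
           almost_geodesic \<Omega> K {0..}
             (\<lambda>t. \<xi> + (\<epsilon> * exp (- 2 * t)) *\<^sub>R inward_normal \<Omega> \<xi>)"
proof (cases "frontier \<Omega> = {}")
  case True
  then show ?thesis by (intro exI[of _ 1] conjI) auto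
next
  case False
  then have mono: "mono_on {0..<2 * r} \<omega>"
    using assms(11) by (auto simp: modulus_of_continuity_on_ball_def)
  have def: "open U" "C1_on U \<rho>" "frontier \<Omega> \<subseteq> U" "\<Omega> \<inter> U = {x \<in> U. \<rho> x < 0}"
      "frontier \<Omega> \<inter> U = {x \<in> U. \<rho> x = 0}"
      "\<And>x. x \<in> frontier \<Omega> \<inter> U \<Longrightarrow> frechet_derivative \<rho> (at x) \<noteq> (\<lambda>v. 0)"
    using assms(9) by (auto simp: defining_function_def defining_function_on_def)
  obtain g where g: "continuous_on U g" "\<And>x. x \<in> U \<Longrightarrow> (\<rho> has_derivative (\<lambda>v. inner (g x) v)) (at x)"
    using C1_on_gradient[OF def(2)] by blast
  have region: "gradient_region \<Omega> U \<rho> g"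
  proof
    show "g x \<noteq> 0" if "x \<in> frontier \<Omega>" for x
      using def(3) def(6)[of x] frechet_derivative_at[OF g(2), of x] that by auto
  qed (use def g in auto)
  interpret gradient_region \<Omega> U \<rho> g by (fact region)
  obtain C d where C: "0 < C" and d: "0 < d"
    and decr: "\<And>\<xi> s. \<xi> \<in> frontier \<Omega> \<Longrightarrow> 0 \<le> s \<Longrightarrow> s < d \<Longrightarrow> \<rho> (\<xi> + s *\<^sub>R inward_normal \<Omega> \<xi>) \<le> - C * s"
    using uniform_normal_decrease[OF assms(4,7,10)] by blast
  define s where "s k = 16 * \<omega> (r / 2 ^ k) / C" for k :: nat
  have s: "summable s"
    using summable_mult[OF Dini_summable_dyadic[OF assms(8) mono], of "16 / C"]
    by (simp add: s_def[abs_def])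
  \<comment> \<open>Discarding the coarse scales makes the total weight less than 1.\<close>
  obtain N1 where N1: "\<And>n. N1 \<le> n \<Longrightarrow> norm (\<Sum>k. s (k + n)) < 1"
    using suminf_exist_split[OF zero_less_one s] by blast
  obtain N2 where N2: "r / d < 2 ^ N2"
    using real_arch_pow[of 2 "r / d"] by auto
  define N where "N = max N1 N2"
  \<comment> \<open>The extra halving gives 2 a_k = r / 2^(k + N), so the weights \<open>c\<close>
    form the tail of \<open>s\<close> from \<open>N\<close> on. Also 2R is below d and at most r,
    and |F(z)| < 2R for |z| < R, as \<open>normal_slice_in_region\<close> requires.\<close>
  define R where "R = r / 2 ^ Suc N"
  have "r / d < 2 ^ N"
    using N2 power_increasing[of N2 N "2::real"] unfolding N_def by linarith
  then have R: "0 < R" "2 * R < d" "2 * R \<le> r"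
    using assms(7) d by (auto simp: R_def field_simps)
  define a where "a k = R / 2 ^ k" for k :: nat
  define c where "c k = s (k + N)" for k
  have a2: "2 * a k = r / 2 ^ (k + N)" for k
    by (simp add: a_def R_def power_add)
  have pos: "0 \<le> \<omega> (r / 2 ^ k)" for k :: nat
  proof -
    have "r / 2 ^ k \<le> r" using assms(7) by (simp add: divide_le_eq)
    then show ?thesis using assms(7,8) by (auto simp: dini_condition_def)
  qed
  interpret bumps c a
  proof
    show "suminf c \<le> 1"
      using N1[of N] by (simp add: c_def[abs_def] N_def)
    show "summable c"
      unfolding c_def[abs_def] using s by (simp only: summable_iff_shift)
  qed (use pos C R in \<open>auto simp: c_def s_def a_def\<close>)
  have "almost_geodesic \<Omega> 4 {0..} (\<lambda>t. \<xi> + (R / 2 * exp (- 2 * t)) *\<^sub>R inward_normal \<Omega> \<xi>)"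
    if \<xi>: "\<xi> \<in> frontier \<Omega>" for \<xi>
  proof (rule almost_geodesic_normal)
    fix z assume z: "0 < Re z" "cmod z < R"
    have "cmod (bump_map c a z) \<le> 2 * cmod z"
      using z by (intro norm_bump_map_le) auto
    moreover have "cmod (bump_map c a z) * \<omega> (cmod (bump_map c a z)) < C * Re (bump_map c a z)"
      using R assms(7) C mono z
      by (intro bump_map_pinched[where R = R and e = "2 * r"]) (auto simp: c_def s_def a2, simp add: a_def)
    ultimately show "\<xi> + bump_map c a z *s inward_normal \<Omega> \<xi> \<in> \<Omega>"
      using z R
      by (intro normal_slice_in_region[OF region \<xi> assms(10)[OF \<xi>] assms(11)[OF \<xi>] decr[OF \<xi>] C]) auto
  qed (use R norm_inward_normal[OF \<xi>] convex_in_half_space[OF assms(5,1) \<xi>] in auto)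
  then show ?thesis
    using R by (intro exI[of _ 4] conjI exI[of _ "R / 2"]) auto
qed

end
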